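(* Let $k\geq 3$ and, for each $n\in\mathbb{N}$, let $\pi$ be a word chosen uniformly at random from $[k]^n$. Write $\mathcal{S}_k(n)=\mathcal{S}_k(\pi)$, $\mathcal{I}_k(n)=\mathcal{I}_k(\pi)$ and $\mathcal{J}_k(n)=\mathcal{J}_k(\pi)$. Then: (i) $E\big(\mathcal{S}_k(n)\big)=\frac{(k-2)(k-1)}{k^2}(n-1)$ for all $n\in\mathbb{N}$; (ii) $\sigma^2\big(\mathcal{S}_k(n)\big)=-\frac{4(k-2)}{k^4}+\frac{(k-2)(3k^2-5k+6)}{k^4}(n-1)$ for all $n\in\mathbb{N}$; (iii) if $k\geq 4$, then, as $n\to\infty$, $E\big(\mathcal{I}_k(n)\big)\to e_1(k)$, where $$e_1(k)=\frac{2}{(k-3)^2U_k\big(\frac{k-1}{2}\big)}+\frac{2U_{k-1}\big(\frac{k-1}{2}\big)}{(k-3)^2U_k\big(\frac{k-1}{2}\big)}+\frac{k^2-3k-2}{(k-3)^2};$$ furthermore $E\big(\mathcal{I}_3(n)\big)=5+o(1)$ as $n\to\infty$; (iv) if $k\geq 4$, then $\sigma^2\big(\mathcal{I}_k(n)\big)=e_1(k)+e_2(k)-e_1(k)^2+o(1)$ as $n\to\infty$, where $e_1(k)$ is as in (iii) and, writing $a=\frac{k-1}{2}$, $$e_2(k)=\frac{-2(6+11k-3k^2)}{(k-3)^3}+\frac{4(3+5k)}{(k-3)^3(k+1)U_k(a)}+\frac{4(k+3)U_{k-1}(a)}{(k-3)^2U_k(a)}+\frac{8k\big(U_{k-1}(a)+1\big)T_{k+1}(a)}{(k-3)^3U_k(a)^2}-\frac{8k^2T_k(a)}{(k-3)^3(k+1)U_k(a)};$$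 furthermore $\sigma^2\big(\mathcal{I}_3(n)\big)=21+o(1)$ as $n\to\infty$; (v) $E\big(\mathcal{J}_k(n)\big)=1+\frac{3k-2}{k^2}(n-1)$ for all $n\in\mathbb{N}$; (vi) $\sigma^2\big(\mathcal{J}_k(n)\big)=\Big(a_k-\frac{(3k-2)(k^2-15k+10)}{k^4}\Big)n+O(1)$ as $n\to\infty$, where $$a_k=\lim_{x\to 1/k}\bigg(\frac{\partial^2}{\partial q^2}L_k(x,q)\Big|_{q=1}-\frac{2(3k-2)^2}{k^4(1-kx)^3}\bigg)(1-kx)^2,$$ with $L_k(x,q)=\sum_{n\geq 0}\sum_{\pi\in[k]^n}q^{\mathcal{J}_k(\pi)}x^n$ (the empty word contributing $1$).
   Context: For $k\in\mathbb{N}$, $[k]=\{1,\dots,k\}$ with its usual linear order (so $1$ and $k$ are not neighbors). A word $\pi=\pi_1\cdots\pi_n\in[k]^n$ is a staircase if $\pi_{i+1}-\pi_i\in\{-1,0,1\}$ for all $i=1,\dots,n-1$. The staircase separation number $\mathcal{S}_k(\pi)$ is the number $d$ such that $\pi$ can be written as a concatenation $\pi^{(1)}\pi^{(2)}\cdots\pi^{(d+1)}$ of maximal staircase subwords, i.e. each $\pi^{(i)}$ is a staircase but $\pi^{(i)}$ followed by the first letter of $\pi^{(i+1)}$ is not a staircase (staircase words have $\mathcal{S}_k=0$); equivalently, $\mathcal{S}_k(\pi)$ is the number of indices $i$ with $|\pi_{i+1}-\pi_i|>1$. $\mathcal{I}_k(\pi)$ is the length of the longest prefix $\pi_1\cdots\pi_r$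 of $\pi$ that is a staircase word (the longest $L$-staircase subword). $\mathcal{J}_k(\pi)$ (length of the longest $L$-staircase subsequence) is defined by setting $i_1=1$ and recursively $i_j=\inf\{m>i_{j-1}:|\pi_m-\pi_{i_{j-1}}|\leq 1\}$ (with $\inf\emptyset=+\infty$), and $\mathcal{J}_k(\pi)=\max\{r: i_r<\infty\}$. $E$ and $\sigma^2$ denote mean and variance. $U_n$ are the Chebyshev polynomials of the second kind ($U_0=1$, $U_1(t)=2t$, $U_n(t)=2tU_{n-1}(t)-U_{n-2}(t)$) and $T_n$ the Chebyshev polynomials of the first kind.
   Formalization: (ii) is proved for n≥2: at n=1 the variance is 0 but the printed right side is negative. In e_2(k) the third denominator is corrected from (k-3)^2 to (k-3)^3, as the printed formula fails for k≥5. The limit defining a_k is taken from x<1/k, where the series converges. *)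

theory Defs
  imports "HOL-Probability.Probability" "HOL-Library.Landau_Symbols"
begin

definition words :: "nat \<Rightarrow> nat \<Rightarrow> nat list set" where
  "words k n = {w. length w = n \<and> set w \<subseteq> {1..k}}"

definition random_word :: "nat \<Rightarrow> nat \<Rightarrow> nat list pmf" where
  "random_word k n = pmf_of_set (words k n)"

definition staircase :: "nat list \<Rightarrow> bool" where
  "staircase w \<longleftrightarrow> (\<forall>i. Suc i < length w \<longrightarrow> int (w ! Suc i) - int (w ! i) \<in> {-1, 0, 1})"

definition staircase_decomposition :: "nat list \<Rightarrow> nat list list \<Rightarrow> bool" where
  "staircase_decomposition w ps \<longleftrightarrow>
     concat ps = w \<and> (\<forall>p \<in> set ps. p \<noteq> [] \<and> staircase p) \<and>
     (\<forall>i. Suc i < length ps \<longrightarrow> \<not> staircase (ps ! i @ [hd (ps ! Suc i)]))"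

text \<open>The separation number is meaningful for nonempty words only, since the factors of a
  decomposition are nonempty. \<open>staircase_sep_eq_card\<close> below shows that the description
  is well defined.\<close>

definition staircase_sep :: "nat list \<Rightarrow> nat" where
  "staircase_sep w = (THE d. \<exists>ps. staircase_decomposition w ps \<and> length ps = d + 1)"

definition L_staircase_subword :: "nat list \<Rightarrow> nat" where
  "L_staircase_subword w = Max {r. r \<le> length w \<and> staircase (take r w)}"

text \<open>\<open>L_index w j\<close> is the 1-based position $i_j$, so that the letter at position \<open>m\<close> is
  \<open>w ! (m - 1)\<close>. The infimum of the empty set is \<open>\<infinity>\<close> in \<open>enat\<close>. The value at \<open>j = 0\<close> is a
  convention which, together with $i_1 = \infty$ for the empty word, gives the empty word
  the length 0.\<close>

fun L_index :: "nat list \<Rightarrow> nat \<Rightarrow> enat" where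
  "L_index w 0 = 0"
| "L_index w (Suc 0) = (if w = [] then \<infinity> else 1)"
| "L_index w (Suc (Suc j)) =
     Inf {enat m |m. L_index w (Suc j) < enat m \<and> m \<le> length w \<and>
       \<bar>int (w ! (m - 1)) - int (w ! (the_enat (L_index w (Suc j)) - 1))\<bar> \<le> 1}"

definition L_staircase_subseq :: "nat list \<Rightarrow> nat" where
  "L_staircase_subseq w = Max {r. L_index w r < \<infinity>}"

definition mean_of :: "(nat list \<Rightarrow> nat) \<Rightarrow> nat \<Rightarrow> nat \<Rightarrow> real" where
  "mean_of X k n = measure_pmf.expectation (random_word k n) (\<lambda>w. real (X w))"

definition variance_of :: "(nat list \<Rightarrow> nat) \<Rightarrow> nat \<Rightarrow> nat \<Rightarrow> real" where
  "variance_of X k n = measure_pmf.variance (random_word k n) (\<lambda>w. real (X w))"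

fun cheb_T :: "nat \<Rightarrow> real \<Rightarrow> real" where
  "cheb_T 0 t = 1"
| "cheb_T (Suc 0) t = t"
| "cheb_T (Suc (Suc n)) t = 2 * t * cheb_T (Suc n) t - cheb_T n t"

fun cheb_U :: "nat \<Rightarrow> real \<Rightarrow> real" where
  "cheb_U 0 t = 1"
| "cheb_U (Suc 0) t = 2 * t"
| "cheb_U (Suc (Suc n)) t = 2 * t * cheb_U (Suc n) t - cheb_U n t"

definition e1 :: "nat \<Rightarrow> real" where
  "e1 k = (let \<kappa> = real k; a = (\<kappa> - 1) / 2 in
     2 / ((\<kappa> - 3)^2 * cheb_U k a)
     + 2 * cheb_U (k - 1) a / ((\<kappa> - 3)^2 * cheb_U k a)
     + (\<kappa>^2 - 3 * \<kappa> - 2) / (\<kappa> - 3)^2)"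

text \<open>In the published formula the third summand has $(k-3)^2$ in its denominator. That is a
  misprint: with the square, the limit of the variance comes out right for \<open>k = 4\<close> but wrong
  for instance for \<open>k = 5\<close>. The exponent has to be 3, as in the other summands.\<close>

definition e2 :: "nat \<Rightarrow> real" where
  "e2 k = (let \<kappa> = real k; a = (\<kappa> - 1) / 2 in
     - 2 * (6 + 11 * \<kappa> - 3 * \<kappa>^2) / (\<kappa> - 3)^3
     + 4 * (3 + 5 * \<kappa>) / ((\<kappa> - 3)^3 * (\<kappa> + 1) * cheb_U k a)
     + 4 * (\<kappa> + 3) * cheb_U (k - 1) a / ((\<kappa> - 3)^3 * cheb_U k a)
     + 8 * \<kappa> * (cheb_U (k - 1) a + 1) * cheb_T (k + 1) a / ((\<kappa> - 3)^3 * (cheb_U k a)^2)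
     - 8 * \<kappa>^2 * cheb_T k a / ((\<kappa> - 3)^3 * (\<kappa> + 1) * cheb_U k a))"

definition L_gf :: "nat \<Rightarrow> real \<Rightarrow> real \<Rightarrow> real" where
  "L_gf k x q = (\<Sum>n. (\<Sum>w \<in> words k n. q ^ L_staircase_subseq w) * x ^ n)"

definition a_fun :: "nat \<Rightarrow> real \<Rightarrow> real" where
  "a_fun k x = ((deriv ^^ 2) (L_gf k x) 1
       - 2 * (3 * real k - 2)^2 / (real k ^ 4 * (1 - real k * x)^3)) * (1 - real k * x)^2"


subsection \<open>Well-definedness of the separation number\<close>

fun breaks :: "nat list \<Rightarrow> nat" where
  "breaks (a # b # w) = (if \<bar>int b - int a\<bar> > 1 then 1 else 0) + breaks (b # w)"
| "breaks _ = 0"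

lemma staircase_Nil [simp]: "staircase []"
  and staircase_single [simp]: "staircase [a]"
  by (simp_all add: staircase_def)

lemma staircase_Cons_Cons:
  "staircase (a # b # w) \<longleftrightarrow> \<bar>int b - int a\<bar> \<le> 1 \<and> staircase (b # w)"
proof -
  have "staircase (a # b # w) \<longleftrightarrow> int b - int a \<in> {-1, 0, 1} \<and> staircase (b # w)"
    (is "?L \<longleftrightarrow> ?R")
  proof
    assume L: ?L
    have "int b - int a \<in> {-1, 0, 1}"
      using L[unfolded staircase_def, rule_format, of 0] by simp
    moreover have "int ((b # w) ! Suc i) - int ((b # w) ! i) \<in> {-1, 0, 1}"
      if "Suc i < length (b # w)" for i
      using L[unfolded staircase_def, rule_format, of "Suc i"] that by simp
    ultimately show ?R by (simp add: staircase_def)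
  next
    assume R: ?R
    have "int ((a # b # w) ! Suc i) - int ((a # b # w) ! i) \<in> {-1, 0, 1}"
      if "Suc i < length (a # b # w)" for i
      using R that by (cases i) (simp_all add: staircase_def)
    then show ?L by (simp add: staircase_def)
  qed
  also have "int b - int a \<in> {-1, 0, 1} \<longleftrightarrow> \<bar>int b - int a\<bar> \<le> 1"
    by auto
  finally show ?thesis .
qed

lemma breaks_eq_card:
  "breaks w = card {i. Suc i < length w \<and> \<bar>int (w ! Suc i) - int (w ! i)\<bar> > 1}"
proof (induction w rule: breaks.induct)
  case (1 a b w)
  let ?A = "\<lambda>w. {i. Suc i < length w \<and> \<bar>int (w ! Suc i) - int (w ! i)\<bar> > (1::int)}"
  have "i \<in> ?A (a # b # w) \<longleftrightarrow>
      i \<in> (if \<bar>int b - int a\<bar> > 1 then {0} else {}) \<union> Suc ` ?A (b # w)" for i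
    by (cases i) auto
  then have "?A (a # b # w) = (if \<bar>int b - int a\<bar> > 1 then {0} else {}) \<union> Suc ` ?A (b # w)"
    by blast
  moreover have "finite (?A (b # w))" by simp
  moreover have "card (Suc ` ?A (b # w)) = card (?A (b # w))" by (simp add: card_image)
  ultimately show ?case using 1 by (simp add: card_insert_if)
qed simp_all

lemma staircase_iff_breaks: "staircase w \<longleftrightarrow> breaks w = 0"
  by (induction w rule: breaks.induct) (auto simp: staircase_Cons_Cons)

lemma breaks_append:
  "u \<noteq> [] \<Longrightarrow> v \<noteq> [] \<Longrightarrow> breaks (u @ v) = breaks (u @ [hd v]) + breaks v"
proof (induction u rule: breaks.induct)
  case ("2_2" a)
  then show ?case by (cases v) auto
qed auto

lemma breaks_snoc:
  "u \<noteq> [] \<Longrightarrow> breaks (u @ [c]) = breaks u + (if \<bar>int c - int (last u)\<bar> > 1 then 1 else 0)"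
  by (induction u rule: breaks.induct) auto

lemma staircase_decomposition_Cons_Cons:
  "staircase_decomposition w (p # q # ps) \<longleftrightarrow>
     p \<noteq> [] \<and> staircase p \<and> \<not> staircase (p @ [hd q]) \<and>
     (\<exists>v. w = p @ v \<and> staircase_decomposition v (q # ps))"
proof -
  have "(\<forall>i. Suc i < length (p # q # ps) \<longrightarrow>
           \<not> staircase ((p # q # ps) ! i @ [hd ((p # q # ps) ! Suc i)])) \<longleftrightarrow>
        \<not> staircase (p @ [hd q]) \<and>
        (\<forall>i. Suc i < length (q # ps) \<longrightarrow>
           \<not> staircase ((q # ps) ! i @ [hd ((q # ps) ! Suc i)]))"
    (is "(\<forall>i. ?P i) \<longleftrightarrow> ?Q \<and> (\<forall>i. ?R i)")
  proof -
    have "(\<forall>i. ?P i) \<longleftrightarrow> ?P 0 \<and> (\<forall>i. ?P (Suc i))"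
      by (metis not0_implies_Suc)
    then show ?thesis by simp
  qed
  then show ?thesis
    unfolding staircase_decomposition_def by auto
qed

lemma length_staircase_decomposition:
  "staircase_decomposition w ps \<Longrightarrow> w \<noteq> [] \<Longrightarrow> length ps = breaks w + 1"
proof (induction ps arbitrary: w rule: induct_list012)
  case 1
  then show ?case by (simp add: staircase_decomposition_def)
next
  case (2 p)
  then show ?case by (auto simp: staircase_decomposition_def staircase_iff_breaks)
next
  case (3 p q ps)
  then obtain v where v: "p \<noteq> []" "staircase p" "\<not> staircase (p @ [hd q])" "w = p @ v"
      "staircase_decomposition v (q # ps)"
    by (auto simp: staircase_decomposition_Cons_Cons)
  then have q: "q \<noteq> []" "v = q @ concat ps"
    by (auto simp: staircase_decomposition_def)
  then have "length (q # ps) = breaks v + 1" using "3.IH"(2) v by blast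
  moreover have "breaks (p @ [hd q]) = 1"
    using v breaks_snoc[of p "hd q"] by (simp add: staircase_iff_breaks split: if_splits)
  moreover have "breaks w = breaks (p @ [hd q]) + breaks v"
    using v q breaks_append[of p v] by simp
  ultimately show ?case by simp
qed

lemma staircase_decomposition_exists:
  "w \<noteq> [] \<Longrightarrow> \<exists>ps. staircase_decomposition w ps"
proof (induction w rule: breaks.induct)
  case (1 a b w)
  then obtain ps where ps: "staircase_decomposition (b # w) ps" by blast
  then obtain p qs where p: "ps = p # qs" "p \<noteq> []" "hd p = b"
    by (cases ps; cases "hd ps") (auto simp: staircase_decomposition_def)
  show ?case
  proof (cases "\<bar>int b - int a\<bar> > 1")
    case True
    then have "staircase_decomposition (a # b # w) ([a] # p # qs)"
      using ps p by (auto simp: staircase_decomposition_Cons_Cons staircase_Cons_Cons)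
    then show ?thesis by blast
  next
    case False
    from p obtain p' where p': "p = b # p'" by (cases p) auto
    have "staircase_decomposition (a # b # w) ((a # p) # qs)"
    proof (cases qs)
      case Nil
      then show ?thesis using ps p p' False
        by (auto simp: staircase_decomposition_def staircase_Cons_Cons)
    next
      case (Cons q rs)
      then show ?thesis using ps p p' False
        by (auto simp: staircase_decomposition_Cons_Cons staircase_Cons_Cons)
    qed
    then show ?thesis by blast
  qed
next
  case ("2_2" a)
  have "staircase_decomposition [a] [[a]]" by (simp add: staircase_decomposition_def)
  then show ?case by blast
qed simp

lemma staircase_sep_eq_card:
  assumes "w \<noteq> []"
  shows "staircase_sep w = card {i. Suc i < length w \<and> \<bar>int (w ! Suc i) - int (w ! i)\<bar> > 1}"
proof -
  obtain ps where ps: "staircase_decomposition w ps"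
    using staircase_decomposition_exists[OF assms] by blast
  have "staircase_sep w = breaks w"
    unfolding staircase_sep_def
  proof (rule the_equality)
    show "\<exists>ps. staircase_decomposition w ps \<and> length ps = breaks w + 1"
      using ps length_staircase_decomposition[OF ps assms] by blast
  next
    fix d assume "\<exists>ps. staircase_decomposition w ps \<and> length ps = d + 1"
    then show "d = breaks w"
      using length_staircase_decomposition[OF _ assms] by auto
  qed
  then show ?thesis by (simp add: breaks_eq_card)
qed

end

theory Submission
  imports Defs
begin

text \<open>All three statistics obey recursions in the first letter, driven by the adjacency operator
  \<open>A\<close> (with loops) of the path on \<open>{1..k}\<close>, which is symmetric; averaging over the first letter
  therefore moves \<open>A\<close> onto the constant function.

  For the staircase prefix the conditional means converge to the solution of \<open>v = 1 + A v / k\<close> with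
  zero boundary values, and by symmetry of \<open>A\<close> the second moment tends to the average of
  \<open>2 v\<^sup>2 - v\<close>. For \<open>k \<ge> 4\<close> the solution is
  \<open>v\<^sub>i = k / (k - 3) * (1 - (U\<^sub>i\<^sub>-\<^sub>1 + U\<^sub>k\<^sub>-\<^sub>i) / U\<^sub>k)\<close>
  at \<open>(k - 1) / 2\<close>, for \<open>k = 3\<close> it is a parabola.

  For the staircase subsequence the current letter is a random walk on the path with uniform
  stationary distribution. The Poisson equation of the walk has a quadratic polynomial as solution,
  so the variance equals a linear function plus a telescoping, hence bounded, correction. This
  correction contributes \<open>O((1 - k x)\<^sup>-\<^sup>1)\<close> to the second derivative of the generating function,
  so the limit \<open>a\<close> is read off from the polynomial part of the second factorial moment.\<close>

text \<open>Otherwise \<open>1\<close> in \<open>{1..k}\<close> would become \<open>Suc 0\<close>,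
  and sums weighted by an indicator would become sums over restricted sets; the product form is the
  one that can be swapped and distributed.\<close>

declare One_nat_def [simp del] sum_of_bool_mult_eq [simp del] sum_mult_of_bool_eq [simp del]
  sum_of_bool_eq [simp del]

section \<open>Adjacency operator of the path, with loops\<close>

definition near :: "nat \<Rightarrow> nat \<Rightarrow> bool" where
  "near b c \<longleftrightarrow> \<bar>int b - int c\<bar> \<le> 1"

lemma near_commute: "near b c \<longleftrightarrow> near c b"
  by (auto simp: near_def)

text \<open>The operator \<open>A\<close>. Only values of \<open>F\<close> on \<open>{1..k}\<close>
  enter, so \<open>F\<close> is free at \<open>0\<close> and \<open>Suc k\<close>.\<close>

definition nbsum :: "nat \<Rightarrow> (nat \<Rightarrow> real) \<Rightarrow> nat \<Rightarrow> real" where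
  "nbsum k F c = (\<Sum>b = 1..k. of_bool (near b c) * F b)"

text \<open>Adjacency is symmetric, so exchanging the two sums moves the operator to the other
  factor.\<close>

lemma sum_nbsum_commute:
  "(\<Sum>c = 1..k. F c * nbsum k G c) = (\<Sum>c = 1..k. nbsum k F c * G c)"
proof -
  have "(\<Sum>c = 1..k. F c * nbsum k G c) = (\<Sum>c = 1..k. \<Sum>b = 1..k. F c * (of_bool (near b c) * G b))"
    by (simp add: nbsum_def sum_distrib_left)
  also have "\<dots> = (\<Sum>b = 1..k. \<Sum>c = 1..k. F c * (of_bool (near b c) * G b))"
    by (rule sum.swap)
  also have "\<dots> = (\<Sum>b = 1..k. nbsum k F b * G b)"
    by (simp add: nbsum_def sum_distrib_left sum_distrib_right near_commute mult_ac)
  finally show ?thesis .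
qed

lemma nbsum_add: "nbsum k (\<lambda>b. F b + G b) c = nbsum k F c + nbsum k G c"
  by (simp add: nbsum_def algebra_simps sum.distrib)

lemma nbsum_diff: "nbsum k (\<lambda>b. F b - G b) c = nbsum k F c - nbsum k G c"
  by (simp add: nbsum_def algebra_simps sum_subtractf)

lemma nbsum_cmult: "nbsum k (\<lambda>b. x * F b) c = x * nbsum k F c"
  by (simp add: nbsum_def sum_distrib_left mult_ac)

lemma nbsum_cong:
  "(\<And>b. b \<in> {1..k} \<Longrightarrow> F b = G b) \<Longrightarrow> nbsum k F c = nbsum k G c"
  by (simp add: nbsum_def)

lemma abs_nbsum_le: "\<bar>nbsum k F c\<bar> \<le> nbsum k (\<lambda>b. \<bar>F b\<bar>) c"
  unfolding nbsum_def by (rule order_trans[OF sum_abs]) (simp add: abs_mult)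

text \<open>With zero values at both ends the sum may run over \<open>{0..Suc k}\<close>, where
  every \<open>c\<close> has two neighbours and no boundary case arises.\<close>

lemma nbsum_eq_zero_boundary:
  assumes "c \<in> {1..k}" "F 0 = 0" "F (Suc k) = 0"
  shows "nbsum k F c = F (c - 1) + F c + F (c + 1)"
proof -
  have "nbsum k F c = (\<Sum>b = 0..Suc k. of_bool (near b c) * F b)"
    using assms by (simp add: nbsum_def sum.atLeast_Suc_atMost[of 0] sum.nat_ivl_Suc' One_nat_def)
  also have "\<dots> = (\<Sum>b \<in> {c - 1, c, c + 1}. of_bool (near b c) * F b)"
    using assms by (intro sum.mono_neutral_right) (auto simp: near_def)
  also have "\<dots> = F (c - 1) + F c + F (c + 1)"
    using assms by (cases c) (simp_all add: near_def)
  finally show ?thesis .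
qed

text \<open>The zero-boundary case, applied to \<open>F\<close> cut off outside
  \<open>{1..k}\<close>.\<close>

lemma nbsum_eq:
  assumes "c \<in> {1..k}"
  shows "nbsum k F c = of_bool (c \<noteq> 1) * F (c - 1) + F c + of_bool (c \<noteq> k) * F (c + 1)"
proof -
  let ?G = "\<lambda>b. of_bool (b \<in> {1..k}) * F b"
  have "nbsum k F c = nbsum k ?G c" by (rule nbsum_cong) simp
  also have "\<dots> = ?G (c - 1) + ?G c + ?G (c + 1)"
    using assms by (intro nbsum_eq_zero_boundary) auto
  finally show ?thesis using assms by (auto simp: of_bool_def)
qed

lemma sum_boundary_interior:
  fixes x y :: real
  assumes "k \<ge> 2"
  shows "(\<Sum>c = 1..k. if c = 1 \<or> c = k then x else y) = 2 * x + (real k - 2) * y"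
proof -
  have "(\<Sum>c = 1..k. if c = 1 \<or> c = k then x else y)
      = (\<Sum>c \<in> insert 1 (insert k {2..<k}). if c = 1 \<or> c = k then x else y)"
    using assms by (intro sum.cong) auto
  also have "\<dots> = 2 * x + (\<Sum>c = 2..<k. if c = 1 \<or> c = k then x else y)"
    using assms by simp
  also have "(\<Sum>c = 2..<k. if c = 1 \<or> c = k then x else y) = (\<Sum>c = 2..<k. y)"
    by (intro sum.cong) auto
  finally show ?thesis using assms by (simp add: of_nat_diff)
qed

subsection \<open>Averages over words\<close>

text \<open>The expectation under \<open>random_word\<close>, as a finite sum from which the first
  letter can be split off.\<close>

definition avg :: "nat \<Rightarrow> nat \<Rightarrow> (nat list \<Rightarrow> real) \<Rightarrow> real" where
  "avg k n F = (\<Sum>w \<in> words k n. F w) / real k ^ n"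

lemma finite_words: "finite (words k n)"
  and card_words: "card (words k n) = k ^ n"
  using finite_lists_length_eq[of "{1..k}" n] card_lists_length_eq[of "{1..k}" n]
  by (simp_all add: words_def conj_commute)

lemma words_nonempty: "k > 0 \<Longrightarrow> words k n \<noteq> {}"
  using card_words[of k n] by force

lemma words_0: "words k 0 = {[]}"
  by (auto simp: words_def)

lemma sum_words_Suc: "(\<Sum>w \<in> words k (Suc n). F w) = (\<Sum>c = 1..k. \<Sum>w \<in> words k n. F (c # w))"
proof -
  have "words k (Suc n) = (\<lambda>(c, w). c # w) ` ({1..k} \<times> words k n)"
    by (auto simp: words_def length_Suc_conv image_iff)
  moreover have "inj_on (\<lambda>(c, w). c # w) ({1..k} \<times> words k n)"
    by (auto intro: inj_onI)
  ultimately have "(\<Sum>w \<in> words k (Suc n). F w) = (\<Sum>(c, w) \<in> {1..k} \<times> words k n. F (c # w))"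
    by (simp add: sum.reindex case_prod_unfold)
  then show ?thesis by (simp add: sum.cartesian_product)
qed

lemma avg_0: "avg k 0 F = F []"
  by (simp add: avg_def words_0)

lemma avg_Suc: "avg k (Suc n) F = (\<Sum>c = 1..k. avg k n (\<lambda>w. F (c # w))) / real k"
  by (simp add: avg_def sum_words_Suc sum_divide_distrib mult_ac)

lemma avg_add: "avg k n (\<lambda>w. F w + G w) = avg k n F + avg k n G"
  by (simp add: avg_def sum.distrib add_divide_distrib)

lemma avg_cmult: "avg k n (\<lambda>w. x * F w) = x * avg k n F"
  by (simp add: avg_def sum_distrib_left)

lemma avg_const: "k > 0 \<Longrightarrow> avg k n (\<lambda>w. x) = x"
  by (simp add: avg_def card_words)

lemma avg_add_const: "k > 0 \<Longrightarrow> avg k n (\<lambda>w. x + F w) = x + avg k n F"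
  by (simp add: avg_add avg_const)

lemma avg_square_add_const:
  "k > 0 \<Longrightarrow> avg k n (\<lambda>w. (x + F w)\<^sup>2) = x\<^sup>2 + 2 * x * avg k n F + avg k n (\<lambda>w. (F w)\<^sup>2)"
  by (simp add: power2_sum avg_add avg_const avg_cmult mult.assoc)

lemma expectation_random_word:
  "k > 0 \<Longrightarrow> measure_pmf.expectation (random_word k n) F = avg k n F"
  by (simp add: random_word_def integral_pmf_of_set finite_words words_nonempty card_words avg_def)

lemma mean_of_eq_avg: "k > 0 \<Longrightarrow> mean_of X k n = avg k n (\<lambda>w. real (X w))"
  by (simp add: mean_of_def expectation_random_word)

lemma variance_of_eq_avg:
  assumes "k > 0"
  shows "variance_of X k n = avg k n (\<lambda>w. (real (X w))\<^sup>2) - (avg k n (\<lambda>w. real (X w)))\<^sup>2"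
  using avg_square_add_const[OF assms, of n "- avg k n (\<lambda>w. real (X w))" "\<lambda>w. real (X w)"]
  by (simp add: variance_of_def expectation_random_word assms power2_eq_square)

text \<open>Common entry point for the three statistics: \<open>Y c\<close> is the statistic once
  the first letter \<open>c\<close> is fixed.\<close>

lemma mean_variance_Suc:
  assumes "k > 0" "\<And>c w. real (X (c # w)) = Y c w"
  shows "mean_of X k (Suc n) = (\<Sum>c = 1..k. avg k n (Y c)) / real k"
    and "variance_of X k (Suc n) =
      (\<Sum>c = 1..k. avg k n (\<lambda>w. (Y c w)\<^sup>2)) / real k - (mean_of X k (Suc n))\<^sup>2"
  using assms by (simp_all add: mean_of_eq_avg variance_of_eq_avg avg_Suc)

text \<open>Second moment minus squared mean, with \<open>x = k\<close> and
  \<open>y = n - 2\<close>. Over plain real variables it reduces to a polynomial identity.\<close>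

lemma staircase_sep_variance_identity:
  fixes x y :: real
  assumes "x \<noteq> 0"
  shows "(x - 1) * (x - 2) / x\<^sup>2 * (y + 1) + 2 * y * ((2 * (x - 2)\<^sup>2 + (x - 2) * (x - 3)\<^sup>2) / x\<^sup>2) / x
      + ((x - 1) * (x - 2) / x\<^sup>2)\<^sup>2 * y * (y - 1) - ((x - 2) * (x - 1) / x\<^sup>2 * (y + 1))\<^sup>2
    = - 4 * (x - 2) / x ^ 4 + (x - 2) * (3 * x\<^sup>2 - 5 * x + 6) / x ^ 4 * (y + 1)"
  using assms by (simp add: divide_simps) algebra

subsection \<open>Separation number\<close>

lemma nbsum_one:
  assumes "k \<ge> 2" "c \<in> {1..k}"
  shows "nbsum k (\<lambda>_. 1) c = (if c = 1 \<or> c = k then 2 else 3)"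
  using assms by (auto simp: nbsum_eq)

text \<open>The probability that a uniform letter is not near \<open>c\<close>; later also part of
  the holding probability of \<open>walk\<close>.\<close>

definition far :: "nat \<Rightarrow> nat \<Rightarrow> real" where
  "far k c = 1 - nbsum k (\<lambda>_. 1) c / real k"

lemma breaks_Cons_Cons:
  "real (breaks (c # b # w)) = of_bool (\<not> near b c) + real (breaks (b # w))"
  by (auto simp: near_def)

lemma sum_not_near:
  "(\<Sum>b = 1..k. of_bool (\<not> near b c) * F b) = (\<Sum>b = 1..k. F b) - nbsum k F c"
proof -
  have "(\<Sum>b = 1..k. of_bool (\<not> near b c) * F b) + nbsum k F c = (\<Sum>b = 1..k. F b)"
    unfolding nbsum_def sum.distrib[symmetric] by (intro sum.cong) auto
  then show ?thesis by simp
qed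

lemma sum_not_near_eq_far:
  "k > 0 \<Longrightarrow> (\<Sum>b = 1..k. of_bool (\<not> near b c)) = real k * far k c"
  using sum_not_near[where F = "\<lambda>_. 1" and k = k and c = c] by (simp add: far_def right_diff_distrib)

context
  fixes k :: nat
  assumes k: "k \<ge> 3"
begin

definition mean_far :: real where
  "mean_far = (real k - 1) * (real k - 2) / (real k)\<^sup>2"

lemma sum_far: "(\<Sum>c = 1..k. far k c) = real k * mean_far"
proof -
  have "(\<Sum>c = 1..k. far k c)
      = (\<Sum>c = 1..k. if c = 1 \<or> c = k then 1 - 2 / real k else 1 - 3 / real k)"
    using k by (intro sum.cong) (auto simp: far_def nbsum_one)
  also have "\<dots> = real k * mean_far"
    using k by (subst sum_boundary_interior)
      (auto simp: mean_far_def field_simps power2_eq_square)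
  finally show ?thesis .
qed

lemma sum_far_square:
  "(\<Sum>c = 1..k. (far k c)\<^sup>2) = (2 * (real k - 2)\<^sup>2 + (real k - 2) * (real k - 3)\<^sup>2) / (real k)\<^sup>2"
proof -
  have "(\<Sum>c = 1..k. (far k c)\<^sup>2)
      = (\<Sum>c = 1..k. if c = 1 \<or> c = k then (1 - 2 / real k)\<^sup>2 else (1 - 3 / real k)\<^sup>2)"
    using k by (intro sum.cong) (auto simp: far_def nbsum_one)
  also have "\<dots> = 2 * (1 - 2 / real k)\<^sup>2 + (real k - 2) * (1 - 3 / real k)\<^sup>2"
    using k by (subst sum_boundary_interior) auto
  moreover have "1 - 2 / real k = (real k - 2) / real k" "1 - 3 / real k = (real k - 3) / real k"
    using k by (simp_all add: diff_divide_distrib)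
  ultimately show ?thesis
    by (simp add: power_divide add_divide_distrib)
qed

text \<open>Only the first of the \<open>n\<close> adjacent pairs involves \<open>c\<close>; each of
  the others starts at a uniform letter and contributes \<open>mean_far\<close>.\<close>

lemma avg_breaks:
  "avg k n (\<lambda>w. real (breaks (c # w))) = (if n = 0 then 0 else far k c + mean_far * real (n - 1))"
proof (induction n arbitrary: c)
  case 0
  then show ?case by (simp add: avg_0)
next
  case (Suc n)
  have "avg k (Suc n) (\<lambda>w. real (breaks (c # w)))
      = (\<Sum>b = 1..k. of_bool (\<not> near b c) + avg k n (\<lambda>w. real (breaks (b # w)))) / k"
    using k by (simp add: avg_Suc breaks_Cons_Cons avg_add_const del: breaks.simps)
  also have "\<dots> = far k c + (\<Sum>b = 1..k. avg k n (\<lambda>w. real (breaks (b # w)))) / k"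
    using k by (simp add: sum.distrib sum_not_near_eq_far add_divide_distrib)
  also have "(\<Sum>b = 1..k. avg k n (\<lambda>w. real (breaks (b # w)))) = real k * (mean_far * real n)"
    unfolding Suc.IH using k by (cases n) (simp_all add: sum.distrib sum_far algebra_simps)
  finally show ?case using k by simp
qed

text \<open>The square counts ordered pairs among \<open>n + 1\<close> adjacencies:
  \<open>n + 1\<close> diagonal pairs, \<open>2 * n\<close> pairs sharing one letter, correlated
  through \<open>far\<close> of that letter, and \<open>n * (n - 1)\<close> independent
  pairs.\<close>

lemma sum_avg_breaks_square:
  "(\<Sum>c = 1..k. avg k (Suc n) (\<lambda>w. (real (breaks (c # w)))\<^sup>2)) / k
     = mean_far * (n + 1) + 2 * n * (\<Sum>c = 1..k. (far k c)\<^sup>2) / k + mean_far\<^sup>2 * n * (real n - 1)"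
proof -
  let ?m = "\<lambda>n c. avg k n (\<lambda>w. real (breaks (c # w)))"
  let ?s = "\<lambda>n c. avg k n (\<lambda>w. (real (breaks (c # w)))\<^sup>2)"
  have not_near: "(\<Sum>c = 1..k. of_bool (\<not> near b c)) = real k * far k b" for b
    using k sum_not_near_eq_far[of k b] by (simp add: near_commute[of b])
  \<comment> \<open>Summing over the first letter before the second one turns the indicator into
    \<open>far k b\<close>, so only the pairing of \<open>far\<close> with the conditional means
    remains.\<close>
  have step: "(\<Sum>c = 1..k. ?s (Suc n) c) / k
      = mean_far + 2 * (\<Sum>b = 1..k. far k b * ?m n b) / k + (\<Sum>b = 1..k. ?s n b) / k" for n
  proof -
    have "avg k n (\<lambda>w. (real (breaks (c # b # w)))\<^sup>2)
        = of_bool (\<not> near b c) * (1 + 2 * ?m n b) + ?s n b" for b c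
      using k by (cases "near b c") (simp_all add: breaks_Cons_Cons avg_square_add_const del: breaks.simps)
    then have "?s (Suc n) c = (\<Sum>b = 1..k. of_bool (\<not> near b c) * (1 + 2 * ?m n b) + ?s n b) / k" for c
      by (simp add: avg_Suc del: breaks.simps)
    then have "(\<Sum>c = 1..k. ?s (Suc n) c)
        = (\<Sum>c = 1..k. \<Sum>b = 1..k. of_bool (\<not> near b c) * (1 + 2 * ?m n b) + ?s n b) / k"
      by (simp add: sum_divide_distrib)
    also have "\<dots> = (\<Sum>b = 1..k. \<Sum>c = 1..k. of_bool (\<not> near b c) * (1 + 2 * ?m n b) + ?s n b) / k"
      by (subst sum.swap) simp
    also have "\<dots> = (\<Sum>b = 1..k. k * far k b * (1 + 2 * ?m n b) + k * ?s n b) / k"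
      unfolding sum.distrib sum_distrib_right[symmetric] not_near by simp
    also have "\<dots> = (\<Sum>b = 1..k. far k b + 2 * (far k b * ?m n b) + ?s n b)"
      using k unfolding sum_divide_distrib by (intro sum.cong) (auto simp: field_simps)
    also have "\<dots> = k * mean_far + 2 * (\<Sum>b = 1..k. far k b * ?m n b) + (\<Sum>b = 1..k. ?s n b)"
      by (simp add: sum.distrib sum_far sum_distrib_left)
    finally show ?thesis using k by (simp add: add_divide_distrib)
  qed
  have cross: "(\<Sum>b = 1..k. far k b * ?m (Suc n) b)
      = (\<Sum>c = 1..k. (far k c)\<^sup>2) + k * mean_far * (mean_far * n)" for n
    by (simp add: avg_breaks distrib_left sum.distrib power2_eq_square
      sum_distrib_right[symmetric] sum_far)
  show ?thesis
  proof (induction n)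
    case 0
    then show ?case by (simp add: step avg_0 avg_breaks)
  next
    case (Suc n)
    show ?case
      using k unfolding step[of "Suc n"] Suc.IH cross by (simp add: field_simps power2_eq_square)
  qed
qed

lemma staircase_sep_eq_breaks: "staircase_sep (c # w) = breaks (c # w)"
  by (simp add: staircase_sep_eq_card breaks_eq_card)

lemma mean_staircase_sep:
  assumes "n \<ge> 1"
  shows "mean_of staircase_sep k n = (real k - 2) * (real k - 1) / real k ^ 2 * (real n - 1)"
proof -
  obtain m where m: "n = Suc m" using assms by (cases n) auto
  have "mean_of staircase_sep k (Suc m) = mean_far * m"
    using k by (subst mean_variance_Suc(1)[OF _ refl]; cases m)
      (simp_all add: staircase_sep_eq_breaks avg_breaks sum.distrib sum_far field_simps
        del: breaks.simps)
  then show ?thesis by (simp add: m mean_far_def)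
qed

text \<open>At \<open>n = 1\<close> the right-hand side is negative, so the formula starts at
  \<open>n = 2\<close>, which is the case \<open>n = 0\<close> of
  \<open>sum_avg_breaks_square\<close>.\<close>

lemma variance_staircase_sep:
  assumes "n \<ge> 2"
  shows "variance_of staircase_sep k n =
    - 4 * (real k - 2) / real k ^ 4
    + (real k - 2) * (3 * real k ^ 2 - 5 * real k + 6) / real k ^ 4 * (real n - 1)"
proof -
  obtain m where m: "n = Suc (Suc m)" using assms by (cases n; cases "n - 1") auto
  have "variance_of staircase_sep k n
      = mean_far * (m + 1) + 2 * m * (\<Sum>c = 1..k. (far k c)\<^sup>2) / k + mean_far\<^sup>2 * m * (real m - 1)
        - ((real k - 2) * (real k - 1) / real k ^ 2 * (real n - 1))\<^sup>2"
    using k unfolding m by (subst mean_variance_Suc(2)[OF _ refl])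
      (simp_all add: staircase_sep_eq_breaks sum_avg_breaks_square mean_staircase_sep
        del: breaks.simps)
  then show ?thesis
    using k staircase_sep_variance_identity[of k m]
    unfolding sum_far_square mean_far_def m by (simp add: algebra_simps)
qed

end

subsection \<open>Longest staircase prefix\<close>

fun run :: "nat \<Rightarrow> nat list \<Rightarrow> nat" where
  "run c [] = 0"
| "run c (b # w) = (if near b c then Suc (run b w) else 0)"

text \<open>The admissible prefix lengths form an initial segment, so their maximum is given by a
  recursion over the letters.\<close>

lemma staircase_take_iff_run:
  "r \<le> length (c # w) \<and> staircase (take r (c # w)) \<longleftrightarrow> r \<le> Suc (run c w)"
proof (induction w arbitrary: c r)
  case Nil
  then show ?case by (cases r) auto
next
  case (Cons b w)
  show ?case
  proof (cases r)
    case 0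
    then show ?thesis by simp
  next
    case (Suc r')
    show ?thesis
    proof (cases r')
      case 0
      then show ?thesis using Suc by simp
    next
      case (Suc r'')
      then show ?thesis
        using \<open>r = Suc r'\<close> Cons.IH[of "Suc r''" b]
        by (auto simp: staircase_Cons_Cons near_def)
    qed
  qed
qed

lemma L_staircase_subword_eq_run: "L_staircase_subword (c # w) = Suc (run c w)"
proof -
  have "{r. r \<le> length (c # w) \<and> staircase (take r (c # w))} = {..Suc (run c w)}"
    using staircase_take_iff_run by auto
  then show ?thesis
    unfolding L_staircase_subword_def by (auto intro: Max_eqI)
qed

section \<open>Moments of the prefix length given the first letter, and their limits\<close>

definition run_mean :: "nat \<Rightarrow> nat \<Rightarrow> nat \<Rightarrow> real" where
  "run_mean k n c = avg k n (\<lambda>w. 1 + real (run c w))"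

definition run_square :: "nat \<Rightarrow> nat \<Rightarrow> nat \<Rightarrow> real" where
  "run_square k n c = avg k n (\<lambda>w. (1 + real (run c w))\<^sup>2)"

lemma run_mean_Suc:
  assumes "k > 0"
  shows "run_mean k (Suc n) c = 1 + nbsum k (run_mean k n) c / real k"
proof -
  have "avg k n (\<lambda>w. 1 + real (run c (b # w))) = 1 + of_bool (near b c) * run_mean k n b" for b
    using assms by (cases "near b c") (simp_all add: run_mean_def avg_const avg_add_const)
  then show ?thesis
    using assms by (simp add: run_mean_def[of k "Suc n"] avg_Suc nbsum_def sum.distrib add_divide_distrib)
qed

lemma run_square_Suc:
  assumes "k > 0"
  shows "run_square k (Suc n) c
    = 1 + nbsum k (\<lambda>b. 2 * run_mean k n b + run_square k n b) c / real k"
proof -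
  \<comment> \<open>The prefix length is one plus the length \<open>X\<close> seen from the next
    letter, and \<open>(1 + X)^2 = 1 + 2 * X + X^2\<close>.\<close>
  have "avg k n (\<lambda>w. (1 + real (run c (b # w)))\<^sup>2)
      = 1 + of_bool (near b c) * (2 * run_mean k n b + run_square k n b)" for b
    using assms avg_square_add_const[OF assms, of n 1 "\<lambda>w. 1 + real (run b w)"]
    by (cases "near b c") (simp_all add: run_mean_def run_square_def avg_const)
  then show ?thesis
    using assms by (simp add: run_square_def[of k "Suc n"] avg_Suc nbsum_def sum.distrib add_divide_distrib)
qed

text \<open>The strict supersolution \<open>v\<close> serves as a weight under which the substochastic operator
  \<open>nbsum k / k\<close> loses the unweighted mass in every step.\<close>

lemma summable_nbsum_recursion:
  fixes x y :: "nat \<Rightarrow> nat \<Rightarrow> real"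
  assumes "k > 0"
    and v: "\<And>c. c \<in> {1..k} \<Longrightarrow> v c > 0"
      "\<And>c. c \<in> {1..k} \<Longrightarrow> nbsum k v c = real k * (v c - 1)"
    and rec: "\<And>n c. c \<in> {1..k} \<Longrightarrow> x (Suc n) c = y n c + nbsum k (x n) c / real k"
    and y: "summable (\<lambda>n. \<Sum>c = 1..k. v c * \<bar>y n c\<bar>)"
  shows "summable (\<lambda>n. \<Sum>c = 1..k. \<bar>x n c\<bar>)"
proof -
  define W where "W n = (\<Sum>c = 1..k. v c * \<bar>x n c\<bar>)" for n
  define \<eta> where "\<eta> n = (\<Sum>c = 1..k. v c * \<bar>y n c\<bar>)" for n
  have nonneg: "W n \<ge> 0" "\<eta> n \<ge> 0" for n
    unfolding W_def \<eta>_def by (intro sum_nonneg; simp add: v(1) less_imp_le)+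
  have step: "W (Suc n) + (\<Sum>c = 1..k. \<bar>x n c\<bar>) \<le> \<eta> n + W n" for n
  proof -
    have "W (Suc n) \<le> (\<Sum>c = 1..k. v c * \<bar>y n c\<bar> + v c * nbsum k (\<lambda>b. \<bar>x n b\<bar>) c / k)"
      unfolding W_def
    proof (rule sum_mono)
      fix c assume c: "c \<in> {1..k}"
      have "\<bar>x (Suc n) c\<bar> \<le> \<bar>y n c\<bar> + \<bar>nbsum k (x n) c\<bar> / k"
        unfolding rec[OF c] by (rule order_trans[OF abs_triangle_ineq]) simp
      also have "\<dots> \<le> \<bar>y n c\<bar> + nbsum k (\<lambda>b. \<bar>x n b\<bar>) c / k"
        by (simp add: abs_nbsum_le divide_right_mono)
      finally have "v c * \<bar>x (Suc n) c\<bar> \<le> v c * (\<bar>y n c\<bar> + nbsum k (\<lambda>b. \<bar>x n b\<bar>) c / k)"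
        using v(1)[OF c] by (intro mult_left_mono) auto
      then show "v c * \<bar>x (Suc n) c\<bar> \<le> v c * \<bar>y n c\<bar> + v c * nbsum k (\<lambda>b. \<bar>x n b\<bar>) c / k"
        by (simp add: distrib_left)
    qed
    also have "\<dots> = \<eta> n + (\<Sum>c = 1..k. nbsum k v c * \<bar>x n c\<bar>) / k"
      by (simp add: sum.distrib \<eta>_def sum_divide_distrib[symmetric] sum_nbsum_commute)
    \<comment> \<open>After the operator has moved onto \<open>v\<close>, the equation for
      \<open>v\<close> leaves the old weighted mass minus the unweighted one.\<close>
    also have "(\<Sum>c = 1..k. nbsum k v c * \<bar>x n c\<bar>) = (\<Sum>c = 1..k. k * (v c * \<bar>x n c\<bar> - \<bar>x n c\<bar>))"
      by (intro sum.cong refl) (simp add: v(2), simp add: algebra_simps)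
    also have "\<dots> / k = W n - (\<Sum>c = 1..k. \<bar>x n c\<bar>)"
      using \<open>k > 0\<close> by (simp add: sum_distrib_left[symmetric] W_def sum_subtractf)
    finally show ?thesis by simp
  qed
  have partial: "(\<Sum>n<N. \<Sum>c = 1..k. \<bar>x n c\<bar>) + W N \<le> W 0 + (\<Sum>n<N. \<eta> n)" for N
  proof (induction N)
    case (Suc N)
    then show ?case using step[of N] by simp
  qed simp
  have "summable \<eta>" using y by (simp add: \<eta>_def[abs_def])
  show ?thesis
  proof (rule bounded_imp_summable)
    fix n
    have "sum \<eta> {..<Suc n} \<le> suminf \<eta>"
      using \<open>summable \<eta>\<close> nonneg by (intro sum_le_suminf) auto
    then show "(\<Sum>n\<le>n. \<Sum>c = 1..k. \<bar>x n c\<bar>) \<le> W 0 + suminf \<eta>"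
      using partial[of "Suc n"] nonneg(1)[of "Suc n"] unfolding lessThan_Suc_atMost by linarith
  qed (simp add: sum_nonneg)
qed

lemma tendsto_0_of_summable_sum_abs:
  fixes x :: "nat \<Rightarrow> nat \<Rightarrow> real"
  assumes "summable (\<lambda>n. \<Sum>c = 1..k. \<bar>x n c\<bar>)" "c \<in> {1..k}"
  shows "(\<lambda>n. x n c) \<longlonglongrightarrow> 0"
proof (rule tendsto_rabs_zero_cancel, rule tendsto_sandwich)
  show "(\<lambda>_. 0 :: real) \<longlonglongrightarrow> 0" "\<forall>\<^sub>F n in sequentially. 0 \<le> \<bar>x n c\<bar>" by simp_all
  show "(\<lambda>n. \<Sum>c = 1..k. \<bar>x n c\<bar>) \<longlonglongrightarrow> 0"
    using assms(1) by (rule summable_LIMSEQ_zero)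
  show "\<forall>\<^sub>F n in sequentially. \<bar>x n c\<bar> \<le> (\<Sum>c = 1..k. \<bar>x n c\<bar>)"
    using assms(2) by (intro always_eventually allI member_le_sum) auto
qed

text \<open>The distance of the means to \<open>v\<close> obeys the homogeneous recursion, hence is
  summable. For the squares only the increments \<open>d\<close> are shown to vanish; pairing their
  recursion with \<open>v\<close> then expresses the sum of the squares through the means and
  \<open>d\<close>.\<close>

lemma run_limits:
  assumes "k > 0"
    and v: "\<And>c. c \<in> {1..k} \<Longrightarrow> v c > 0"
      "\<And>c. c \<in> {1..k} \<Longrightarrow> nbsum k v c = real k * (v c - 1)"
  shows "mean_of L_staircase_subword k \<longlonglongrightarrow> (\<Sum>c = 1..k. v c) / k" (is ?mean)
    and "variance_of L_staircase_subword k \<longlonglongrightarrow>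
      (\<Sum>c = 1..k. 2 * (v c)\<^sup>2 - v c) / k - ((\<Sum>c = 1..k. v c) / k)\<^sup>2" (is ?variance)
proof -
  define e where "e n c = run_mean k (Suc n) c - run_mean k n c" for n c
  define d where "d n c = run_square k (Suc n) c - run_square k n c" for n c
  note summable = summable_nbsum_recursion[OF \<open>k > 0\<close> v]
  have "summable (\<lambda>n. \<Sum>c = 1..k. \<bar>run_mean k n c - v c\<bar>)"
    using \<open>k > 0\<close> v(2)
    by (intro summable[where y = "\<lambda>_ _. 0"])
      (simp_all add: run_mean_Suc nbsum_diff diff_divide_distrib)
  then have lim_mean: "(\<lambda>n. run_mean k n c) \<longlonglongrightarrow> v c" if "c \<in> {1..k}" for c
    using tendsto_0_of_summable_sum_abs[where x = "\<lambda>n c. run_mean k n c - v c", OF _ that]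
    by (simp add: LIM_zero_iff)
  have e_Suc: "e (Suc n) c = nbsum k (e n) c / k" for n c
    using \<open>k > 0\<close> unfolding e_def run_mean_Suc[OF \<open>k > 0\<close>, of "Suc n"] run_mean_Suc[OF \<open>k > 0\<close>, of n c]
      nbsum_diff by (simp add: diff_divide_distrib)
  have d_Suc: "d (Suc n) c = 2 * nbsum k (e n) c / k + nbsum k (d n) c / k" for n c
    unfolding d_def e_def run_square_Suc[OF \<open>k > 0\<close>, of "Suc n"] run_square_Suc[OF \<open>k > 0\<close>, of n c]
      nbsum_diff nbsum_add nbsum_cmult
    by (simp add: diff_divide_distrib add_divide_distrib)
  have e: "summable (\<lambda>n. \<Sum>c = 1..k. \<bar>e n c\<bar>)"
    using \<open>k > 0\<close>
    by (intro summable[where y = "\<lambda>_ _. 0"]) (simp_all add: e_Suc)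
  \<comment> \<open>The source term in the recursion for \<open>d\<close> is controlled by
    \<open>e\<close>: the operator moves onto \<open>v\<close>, and
    \<open>nbsum k v c / k = v c - 1\<close> is at most the sum of all \<open>v c\<close>.\<close>
  have "summable (\<lambda>n. \<Sum>c = 1..k. v c * \<bar>2 * nbsum k (e n) c / k\<bar>)"
  proof (rule summable_comparison_test')
    show "summable (\<lambda>n. 2 * (\<Sum>c = 1..k. v c) * (\<Sum>c = 1..k. \<bar>e n c\<bar>))"
      using e by (rule summable_mult)
    fix n :: nat
    have "(\<Sum>c = 1..k. v c * \<bar>2 * nbsum k (e n) c / k\<bar>)
        \<le> (\<Sum>c = 1..k. 2 / k * (v c * nbsum k (\<lambda>b. \<bar>e n b\<bar>) c))"
    proof (rule sum_mono)
      fix c assume "c \<in> {1..k}"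
      then show "v c * \<bar>2 * nbsum k (e n) c / k\<bar> \<le> 2 / k * (v c * nbsum k (\<lambda>b. \<bar>e n b\<bar>) c)"
        using v(1)[of c] abs_nbsum_le[of k "e n" c] \<open>k > 0\<close>
        by (simp add: abs_mult divide_right_mono mult_left_mono)
    qed
    also have "\<dots> = (\<Sum>c = 1..k. 2 / k * (nbsum k v c * \<bar>e n c\<bar>))"
      by (simp only: sum_distrib_left[symmetric] sum_nbsum_commute)
    also have "\<dots> \<le> (\<Sum>c = 1..k. 2 * (\<Sum>c = 1..k. v c) * \<bar>e n c\<bar>)"
    proof (rule sum_mono)
      fix c assume c: "c \<in> {1..k}"
      have "v c \<le> (\<Sum>c = 1..k. v c)"
        using c v(1) by (intro member_le_sum) (auto intro: less_imp_le)
      then have "(v c - 1) * \<bar>e n c\<bar> \<le> (\<Sum>c = 1..k. v c) * \<bar>e n c\<bar>"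
        by (intro mult_right_mono) auto
      then show "2 / k * (nbsum k v c * \<bar>e n c\<bar>) \<le> 2 * (\<Sum>c = 1..k. v c) * \<bar>e n c\<bar>"
        using v(2)[OF c] \<open>k > 0\<close> by simp
    qed
    also have "\<dots> = 2 * (\<Sum>c = 1..k. v c) * (\<Sum>c = 1..k. \<bar>e n c\<bar>)"
      by (simp add: sum_distrib_left)
    finally show "norm (\<Sum>c = 1..k. v c * \<bar>2 * nbsum k (e n) c / k\<bar>)
        \<le> 2 * (\<Sum>c = 1..k. v c) * (\<Sum>c = 1..k. \<bar>e n c\<bar>)"
      by (subst real_norm_def, subst abs_of_nonneg)
        (intro sum_nonneg, simp_all add: v(1) less_imp_le)
  qed
  then have "summable (\<lambda>n. \<Sum>c = 1..k. \<bar>d n c\<bar>)"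
    using \<open>k > 0\<close>
    by (intro summable[where y = "\<lambda>n c. 2 * nbsum k (e n) c / k"])
      (simp_all add: d_Suc)
  then have lim_d: "(\<lambda>n. d n c) \<longlonglongrightarrow> 0" if "c \<in> {1..k}" for c
    by (rule tendsto_0_of_summable_sum_abs[OF _ that])
  \<comment> \<open>The weighted sums of \<open>run_square\<close> at \<open>Suc n\<close> and at
    \<open>n\<close> differ by the pairing of \<open>v\<close> with \<open>d\<close>; the summand
    \<open>- 1\<close> in \<open>v c - 1\<close> isolates the unweighted sum.\<close>
  have square: "(\<Sum>c = 1..k. run_square k n c)
      = (\<Sum>c = 1..k. v c + (v c - 1) * (2 * run_mean k n c) - v c * d n c)" for n
  proof -
    have "(\<Sum>c = 1..k. v c * run_square k (Suc n) c)
        = (\<Sum>c = 1..k. v c) + (\<Sum>c = 1..k. v c * nbsum k (\<lambda>b. 2 * run_mean k n b + run_square k n b) c) / k"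
      using \<open>k > 0\<close> by (simp add: run_square_Suc distrib_left sum.distrib sum_divide_distrib)
    also have "(\<Sum>c = 1..k. v c * nbsum k (\<lambda>b. 2 * run_mean k n b + run_square k n b) c)
        = (\<Sum>c = 1..k. k * ((v c - 1) * (2 * run_mean k n c + run_square k n c)))"
      unfolding sum_nbsum_commute by (intro sum.cong refl) (simp add: v(2))
    also have "\<dots> / k = (\<Sum>c = 1..k. (v c - 1) * (2 * run_mean k n c + run_square k n c))"
      using \<open>k > 0\<close> by (simp add: sum_distrib_left[symmetric])
    finally show ?thesis
      by (simp add: d_def algebra_simps sum.distrib sum_subtractf)
  qed
  have "(\<lambda>n. \<Sum>c = 1..k. run_square k n c) \<longlonglongrightarrow>
      (\<Sum>c = 1..k. v c + (v c - 1) * (2 * v c) - v c * 0)"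
    unfolding square by (intro tendsto_intros lim_mean lim_d)
  then have lim_square: "(\<lambda>n. \<Sum>c = 1..k. run_square k n c) \<longlonglongrightarrow> (\<Sum>c = 1..k. 2 * (v c)\<^sup>2 - v c)"
    by (simp add: algebra_simps power2_eq_square)
  have run: "real (L_staircase_subword (c # w)) = 1 + real (run c w)" for c w
    by (simp add: L_staircase_subword_eq_run)
  have "(\<lambda>n. mean_of L_staircase_subword k (Suc n)) \<longlonglongrightarrow> (\<Sum>c = 1..k. v c) / k"
    unfolding mean_variance_Suc(1)[where Y = "\<lambda>c w. 1 + real (run c w)", OF \<open>k > 0\<close> run] run_mean_def[symmetric]
    by (intro tendsto_intros lim_mean) (use \<open>k > 0\<close> in auto)
  then show ?mean by (simp only: filterlim_sequentially_Suc)
  from this[THEN LIMSEQ_Suc] have "(\<lambda>n. variance_of L_staircase_subword k (Suc n)) \<longlonglongrightarrow>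
      (\<Sum>c = 1..k. 2 * (v c)\<^sup>2 - v c) / k - ((\<Sum>c = 1..k. v c) / k)\<^sup>2"
    unfolding mean_variance_Suc(2)[where Y = "\<lambda>c w. 1 + real (run c w)", OF \<open>k > 0\<close> run] run_square_def[symmetric]
    by (intro tendsto_intros lim_square) (use \<open>k > 0\<close> in auto)
  then show ?variance by (simp only: filterlim_sequentially_Suc)
qed

text \<open>Discrete minimum principle: at a nonpositive interior minimum \<open>m\<close> the
  equation would give \<open>(k - 3) * m >= k > 0\<close>, against \<open>k >= 3\<close>.\<close>

lemma dirichlet_positive:
  assumes "k \<ge> 3" "v 0 = 0" "v (Suc k) = 0"
    and rec: "\<And>c. c \<in> {1..k} \<Longrightarrow> (real k - 1) * v c = v (c - 1) + v (c + 1) + real k"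
    and c: "c \<in> {1..k}"
  shows "v c > 0"
proof (rule ccontr)
  assume "\<not> v c > 0"
  define m where "m = Min (v ` {0..Suc k})"
  have m_le: "m \<le> v b" if "b \<le> Suc k" for b
    using that unfolding m_def by (intro Min_le) auto
  \<comment> \<open>Either the minimum is taken at \<open>c\<close>, or it lies below
    \<open>v c <= 0\<close> and hence below the two boundary values.\<close>
  obtain b where b: "b \<in> {1..k}" "v b = m"
  proof (cases "m = v c")
    case False
    have "m \<in> v ` {0..Suc k}" unfolding m_def by (intro Min_in) auto
    then obtain b where "b \<le> Suc k" "v b = m" by auto
    moreover have "v b < 0" using m_le[of c] c False \<open>\<not> v c > 0\<close> \<open>v b = m\<close> by auto
    ultimately show ?thesis using assms(2,3) that[of b] by (cases "b = 0"; cases "b = Suc k") auto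
  qed (use c that in auto)
  have "m \<le> 0" using m_le[of 0] assms(2) by simp
  have "(real k - 1) * m \<ge> 2 * m + k"
    using rec[OF b(1)] m_le[of "b - 1"] m_le[of "b + 1"] b
    by (smt (verit) atLeastAtMost_iff diff_le_self le_SucI le_trans Suc_eq_plus1 Suc_le_mono)
  moreover have "(real k - 3) * m \<le> 0"
    using \<open>m \<le> 0\<close> assms(1) by (intro mult_nonneg_nonpos) auto
  ultimately show False using assms(1) by (simp add: algebra_simps)
qed

text \<open>The fixed point equation with the loop term brought to the left, whence the factor
  \<open>k - 1\<close>.\<close>

lemma run_limits_dirichlet:
  assumes "k \<ge> 3" "v 0 = 0" "v (Suc k) = 0"
    and rec: "\<And>c. c \<in> {1..k} \<Longrightarrow> (real k - 1) * v c = v (c - 1) + v (c + 1) + real k"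
  shows "mean_of L_staircase_subword k \<longlonglongrightarrow> (\<Sum>c = 1..k. v c) / k"
    and "variance_of L_staircase_subword k \<longlonglongrightarrow>
      (\<Sum>c = 1..k. 2 * (v c)\<^sup>2 - v c) / k - ((\<Sum>c = 1..k. v c) / k)\<^sup>2"
proof -
  have pos: "v c > 0" if "c \<in> {1..k}" for c
    using dirichlet_positive[OF assms that] .
  have fp: "nbsum k v c = real k * (v c - 1)" if "c \<in> {1..k}" for c
    using rec[OF that] that assms(2,3) by (simp add: nbsum_eq_zero_boundary algebra_simps)
  show "mean_of L_staircase_subword k \<longlonglongrightarrow> (\<Sum>c = 1..k. v c) / k"
    "variance_of L_staircase_subword k \<longlonglongrightarrow>
      (\<Sum>c = 1..k. 2 * (v c)\<^sup>2 - v c) / k - ((\<Sum>c = 1..k. v c) / k)\<^sup>2"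
    using run_limits[OF _ pos fp] assms(1) by auto
qed

lemma run_limits_3:
  "mean_of L_staircase_subword 3 \<longlonglongrightarrow> 5" "variance_of L_staircase_subword 3 \<longlonglongrightarrow> 21"
proof -
  \<comment> \<open>For \<open>k = 3\<close> the equation prescribes the second difference
    \<open>-3\<close>; this is the parabola with zeros \<open>0\<close> and
    \<open>4\<close>.\<close>
  define v :: "nat \<Rightarrow> real" where "v c = 3 / 2 * real c * (4 - real c)" for c
  have "(real 3 - 1) * v c = v (c - 1) + v (c + 1) + real 3" if "c \<in> {1..3}" for c
  proof -
    have "c = 1 \<or> c = 2 \<or> c = 3" using that by auto
    then show ?thesis by (auto simp: v_def)
  qed
  moreover have "v 0 = 0" "v (Suc 3) = 0" by (simp_all add: v_def)
  moreover have "{1..3::nat} = {1, 2, 3}" by auto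
  ultimately show "mean_of L_staircase_subword 3 \<longlonglongrightarrow> 5" "variance_of L_staircase_subword 3 \<longlonglongrightarrow> 21"
    using run_limits_dirichlet[of 3 v] by (simp_all add: v_def power2_eq_square)
qed

subsection \<open>Chebyshev sums\<close>

text \<open>\<open>cheb_S (n + 1) = cheb_U n\<close>; the shift supplies the value 0 of the missing polynomial with
  index \<open>-1\<close>.\<close>

fun cheb_S :: "nat \<Rightarrow> real \<Rightarrow> real" where
  "cheb_S 0 t = 0"
| "cheb_S (Suc n) t = cheb_U n t"

lemma cheb_S_Suc_Suc: "cheb_S (Suc (Suc n)) t = 2 * t * cheb_S (Suc n) t - cheb_S n t"
  by (cases n) auto

text \<open>Addition formulas: at \<open>t = cos x\<close>, \<open>cheb_T n\<close> is
  \<open>cos (n x)\<close> and \<open>cheb_S n\<close> is \<open>sin (n x) / sin x\<close>. Being of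
  first order in the pair, they make the later identities accessible to induction and polynomial
  algebra.\<close>

lemma cheb_Suc:
  "cheb_S (Suc n) t = t * cheb_S n t + cheb_T n t"
  "cheb_T (Suc n) t = t * cheb_T n t + (t\<^sup>2 - 1) * cheb_S n t"
proof -
  have "cheb_S (Suc n) t = t * cheb_S n t + cheb_T n t \<and>
      cheb_T (Suc n) t = t * cheb_T n t + (t\<^sup>2 - 1) * cheb_S n t"
  proof (induction n)
    case (Suc n)
    then show ?case
      unfolding cheb_S_Suc_Suc cheb_T.simps by algebra
  qed simp
  then show "cheb_S (Suc n) t = t * cheb_S n t + cheb_T n t"
    "cheb_T (Suc n) t = t * cheb_T n t + (t\<^sup>2 - 1) * cheb_S n t" by auto
qed

text \<open>The polynomial form of \<open>cos^2 + sin^2 = 1\<close>.\<close>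

lemma cheb_pell: "(cheb_T n t)\<^sup>2 = 1 + (t\<^sup>2 - 1) * (cheb_S n t)\<^sup>2"
proof (induction n)
  case (Suc n)
  then show ?case unfolding cheb_Suc by algebra
qed simp

text \<open>By the three-term recursion each summand is a second difference, so the sum
  telescopes.\<close>

lemma sum_cheb_S:
  "2 * (t - 1) * (\<Sum>j = 1..n. cheb_S j t) = cheb_S (Suc n) t - cheb_S n t - 1"
proof (induction n)
  case (Suc n)
  then show ?case by (simp add: cheb_S_Suc_Suc algebra_simps del: cheb_S.simps(2))
qed simp

text \<open>At \<open>t = cos x\<close> the summand is \<open>2 * cos (2 j x) - 2\<close>, and the
  two products on the right form the Dirichlet kernel
  \<open>sin ((2 n + 1) x) / sin x\<close>.\<close>

lemma sum_cheb_S_square: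
  "4 * (t\<^sup>2 - 1) * (\<Sum>j = 1..n. (cheb_S j t)\<^sup>2)
    = cheb_S (Suc n) t * cheb_T n t + cheb_T (Suc n) t * cheb_S n t - 1 - 2 * real n"
proof (induction n)
  case (Suc n)
  have "4 * (t\<^sup>2 - 1) * (cheb_S (Suc n) t)\<^sup>2 + 2
      = cheb_S (Suc (Suc n)) t * cheb_T (Suc n) t + cheb_T (Suc (Suc n)) t * cheb_S (Suc n) t
        - (cheb_S (Suc n) t * cheb_T n t + cheb_T (Suc n) t * cheb_S n t)"
    using cheb_pell[of n t] unfolding cheb_Suc by algebra
  then show ?case using Suc by (simp add: algebra_simps del: cheb_S.simps(2) cheb_T.simps(3))
qed simp

text \<open>The mixed convolution \<open>Q\<close> closes the system: by the addition formulas
  \<open>P\<close> and \<open>Q\<close> together obey a first-order recursion, and their closed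
  forms follow by one induction.\<close>

lemma cheb_convolution:
  "2 * (t\<^sup>2 - 1) * (\<Sum>i\<le>n. cheb_S i t * cheb_S (n - i) t)
      = (real n + 1) * cheb_T n t - cheb_S (Suc n) t"
proof -
  define P where "P n = (\<Sum>i\<le>n. cheb_S i t * cheb_S (n - i) t)" for n
  define Q where "Q n = (\<Sum>i\<le>n. cheb_T i t * cheb_S (n - i) t)" for n
  have P_Suc: "P (Suc n) = t * P n + Q n" for n
    unfolding P_def Q_def sum.atMost_Suc_shift
    by (simp add: cheb_Suc sum.distrib sum_distrib_left algebra_simps del: cheb_S.simps(2))
  have Q_Suc: "Q (Suc n) = cheb_S (Suc n) t + t * Q n + (t\<^sup>2 - 1) * P n" for n
    unfolding P_def Q_def sum.atMost_Suc_shift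
    by (simp add: cheb_Suc(2) sum.distrib sum_distrib_left algebra_simps sum_subtractf
      del: cheb_S.simps(2) cheb_T.simps(2,3))
  have "2 * (t\<^sup>2 - 1) * P n = (real n + 1) * cheb_T n t - cheb_S (Suc n) t \<and>
      2 * Q n = (real n + 1) * cheb_S n t"
  proof (induction n)
    case 0
    then show ?case by (simp add: P_def Q_def)
  next
    case (Suc n)
    then show ?case
      unfolding P_Suc Q_Suc cheb_Suc of_nat_Suc by algebra
  qed
  then show ?thesis by (simp add: P_def)
qed

text \<open>For \<open>t >= 1\<close> the sequence never decreases from its initial value 1. At
  \<open>(k - 1) / 2\<close> this keeps the denominators nonzero.\<close>

lemma cheb_U_ge_1:
  assumes "t \<ge> 1"
  shows "cheb_U n t \<ge> 1"
proof -
  have "cheb_U n t \<ge> 1 \<and> cheb_U (Suc n) t \<ge> cheb_U n t"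
  proof (induction n)
    case 0
    then show ?case using assms by simp
  next
    case (Suc n)
    then have "1 * cheb_U (Suc n) t \<le> t * cheb_U (Suc n) t"
      using assms by (intro mult_right_mono) auto
    then show ?case using Suc unfolding cheb_U.simps(3) by linarith
  qed
  then show ?thesis ..
qed

subsection \<open>Closed form of the limits\<close>

context
  fixes k :: nat and a :: real
  assumes k: "k \<ge> 4"
  defines "a \<equiv> (real k - 1) / 2"
begin

text \<open>The solution of the homogeneous equation with value 1 at \<open>0\<close> and at
  \<open>Suc k\<close>, built from \<open>cheb_S\<close> and its mirror image.\<close>

definition boundary_profile :: "nat \<Rightarrow> real" where
  "boundary_profile c = (cheb_S c a + cheb_S (Suc k - c) a) / cheb_U k a"

text \<open>The constant \<open>k / (k - 3)\<close> solves the inhomogeneous equation;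
  \<open>boundary_profile\<close> corrects its boundary values to zero.\<close>

definition dirichlet :: "nat \<Rightarrow> real" where
  "dirichlet c = real k / (real k - 3) * (1 - boundary_profile c)"

lemma cheb_U_pos: "cheb_U k a > 0"
  using cheb_U_ge_1[of a k] k by (simp add: a_def)

lemma cheb_S_rec: "c \<ge> 1 \<Longrightarrow> (real k - 1) * cheb_S c a = cheb_S (c - 1) a + cheb_S (c + 1) a"
  by (cases c) (simp_all add: a_def cheb_S_Suc_Suc One_nat_def del: cheb_S.simps(2))

lemma dirichlet_boundary: "dirichlet 0 = 0" "dirichlet (Suc k) = 0"
  using cheb_U_pos by (simp_all add: dirichlet_def boundary_profile_def)

lemma dirichlet_rec:
  assumes "c \<in> {1..k}"
  shows "(real k - 1) * dirichlet c = dirichlet (c - 1) + dirichlet (c + 1) + real k"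
proof -
  have "Suc k - c - 1 = Suc k - (c + 1)" "Suc k - c + 1 = Suc k - (c - 1)"
    using assms by auto
  moreover have "1 \<le> Suc k - c" using assms by auto
  ultimately have "(real k - 1) * cheb_S (Suc k - c) a
      = cheb_S (Suc k - (c - 1)) a + cheb_S (Suc k - (c + 1)) a"
    using cheb_S_rec[of "Suc k - c"] by (simp only: add.commute)
  with cheb_S_rec[of c] assms
  have "(real k - 1) * boundary_profile c = boundary_profile (c - 1) + boundary_profile (c + 1)"
    using cheb_U_pos unfolding boundary_profile_def
    by (simp only: add_divide_distrib[symmetric] times_divide_eq_right distrib_left) simp
  moreover have "real k / (real k - 3) * (real k - 3) = real k"
    using k by simp
  ultimately show ?thesis
    unfolding dirichlet_def by algebra
qed

lemma sum_boundary_profile: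
  "(\<Sum>c = 1..k. boundary_profile c) = 2 * (\<Sum>c = 1..k. cheb_S c a) / cheb_U k a"
proof -
  have "(\<Sum>c = 1..k. cheb_S (Suc k - c) a) = (\<Sum>c = 1..k. cheb_S c a)"
    by (rule sum.reindex_bij_witness[of _ "\<lambda>c. Suc k - c" "\<lambda>c. Suc k - c"]) auto
  then show ?thesis
    by (simp add: boundary_profile_def sum_divide_distrib[symmetric] sum.distrib)
qed

text \<open>The squares agree by reflection and the cross terms form a convolution, to which the end
  indices add nothing because \<open>cheb_S 0\<close> vanishes.\<close>

lemma sum_boundary_profile_square:
  "(\<Sum>c = 1..k. (boundary_profile c)\<^sup>2)
    = (2 * (\<Sum>c = 1..k. (cheb_S c a)\<^sup>2) + 2 * (\<Sum>i\<le>Suc k. cheb_S i a * cheb_S (Suc k - i) a))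
      / (cheb_U k a)\<^sup>2"
proof -
  have "(\<Sum>c = 1..k. (cheb_S (Suc k - c) a)\<^sup>2) = (\<Sum>c = 1..k. (cheb_S c a)\<^sup>2)"
    by (rule sum.reindex_bij_witness[of _ "\<lambda>c. Suc k - c" "\<lambda>c. Suc k - c"]) auto
  moreover have "(\<Sum>i\<le>Suc k. cheb_S i a * cheb_S (Suc k - i) a)
      = (\<Sum>i = 1..k. cheb_S i a * cheb_S (Suc k - i) a)"
    by (intro sum.mono_neutral_right) (auto simp: not_less_eq_eq Suc_le_eq le_Suc_eq)
  ultimately show ?thesis
    by (simp add: boundary_profile_def power_divide sum_divide_distrib[symmetric] power2_sum
      sum.distrib sum_distrib_left mult.assoc del: sum.atMost_Suc)
qed

text \<open>All sums reduce to \<open>U\<close>, \<open>S\<close>, \<open>C\<close> and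
  \<open>C'\<close>. The mean is then a plain rational identity; the second moment also needs the
  relations \<open>U\<close>, \<open>C'\<close> and \<open>pell\<close> between these
  values.\<close>

lemma
  shows mean_limit: "(\<Sum>c = 1..k. dirichlet c) / k = e1 k"
    and square_limit: "(\<Sum>c = 1..k. 2 * (dirichlet c)\<^sup>2 - dirichlet c) / k = e1 k + e2 k"
proof -
  define x where "x = real k"
  define U where "U = cheb_U k a"
  define S where "S = cheb_S k a"
  define C where "C = cheb_T k a"
  define C' where "C' = cheb_T (Suc k) a"
  define s1 where "s1 = (\<Sum>c = 1..k. cheb_S c a)"
  define s2 where "s2 = (\<Sum>c = 1..k. (cheb_S c a)\<^sup>2)"
  define p where "p = (\<Sum>i\<le>Suc k. cheb_S i a * cheb_S (Suc k - i) a)"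
  have x: "x \<noteq> 0" "x \<noteq> 3" "x + 1 \<noteq> 0" "x - 3 \<noteq> 0" using k by (auto simp: x_def)
  have U0: "U \<noteq> 0" using cheb_U_pos by (simp add: U_def)
  have a: "a = (x - 1) / 2" by (simp add: a_def x_def)
  \<comment> \<open>This factorisation is the source of \<open>x + 1\<close> in the denominators
    and, with \<open>2 * (a - 1) = x - 3\<close>, of the powers of \<open>x - 3\<close>.\<close>
  have D: "a\<^sup>2 - 1 = (x - 3) * (x + 1) / 4"
    by (simp add: a field_simps power2_eq_square)
  have U: "2 * U = (x - 1) * S + 2 * C"
    using cheb_Suc(1)[of k a] by (simp add: U_def S_def C_def a field_simps)
  have C': "4 * C' = 2 * (x - 1) * C + (x - 3) * (x + 1) * S"
    using cheb_Suc(2)[of k a] unfolding D C'_def S_def C_def a by (simp add: field_simps power2_eq_square)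
  have pell: "4 * C\<^sup>2 = 4 + (x - 3) * (x + 1) * S\<^sup>2"
    using cheb_pell[of k a] unfolding D S_def C_def by (simp add: field_simps)
  have s1: "s1 = (U - S - 1) / (x - 3)"
    using sum_cheb_S[of a k] x unfolding s1_def U_def S_def a by (simp add: field_simps)
  have s2: "s2 = (U * C + C' * S - 1 - 2 * x) / ((x - 3) * (x + 1))"
  proof -
    have "(x - 3) * (x + 1) * s2 = U * C + C' * S - 1 - 2 * x"
      using sum_cheb_S_square[of a k] unfolding D s2_def U_def S_def C_def C'_def x_def by simp
    then show ?thesis using x by (simp add: eq_divide_eq mult_ac)
  qed
  have p: "p = ((x + 1) * C' - (x - 1) / 2 * U) * 2 / ((x - 3) * (x + 1))"
  proof -
    have "2 * ((x - 3) * (x + 1) / 4) * p = (real (Suc k) + 1) * C' - cheb_S (Suc (Suc k)) a"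
      using cheb_convolution[of a "Suc k"] unfolding D p_def C'_def .
    also have "cheb_S (Suc (Suc k)) a = a * U + C'"
      using cheb_Suc(1)[of "Suc k" a] by (simp add: U_def C'_def)
    finally have "(x - 3) * (x + 1) * p = ((x + 1) * C' - (x - 1) / 2 * U) * 2"
      by (simp add: a x_def field_simps)
    then show ?thesis using x by (simp add: eq_divide_eq mult_ac)
  qed
  have S: "cheb_U (k - 1) a = S" using k by (cases k) (auto simp: S_def)
  have e1: "e1 k = 2 / ((x - 3)\<^sup>2 * U) + 2 * S / ((x - 3)\<^sup>2 * U) + (x\<^sup>2 - 3 * x - 2) / (x - 3)\<^sup>2"
    by (simp add: e1_def Let_def a_def[symmetric] S x_def U_def)
  have h1: "(\<Sum>c = 1..k. boundary_profile c) = 2 * s1 / U"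
    by (simp add: sum_boundary_profile s1_def U_def)
  have h2: "(\<Sum>c = 1..k. (boundary_profile c)\<^sup>2) = 2 * (s2 + p) / U\<^sup>2"
    by (simp add: sum_boundary_profile_square s2_def p_def U_def)
  have d1: "(\<Sum>c = 1..k. dirichlet c) = x / (x - 3) * (x - 2 * s1 / U)"
    unfolding h1[symmetric] dirichlet_def sum_distrib_left[symmetric] sum_subtractf
    by (simp add: x_def)
  have d2: "(\<Sum>c = 1..k. (dirichlet c)\<^sup>2) = (x / (x - 3))\<^sup>2 * (x - 2 * (2 * s1 / U) + 2 * (s2 + p) / U\<^sup>2)"
    unfolding h1[symmetric] h2[symmetric] dirichlet_def power_mult_distrib
      sum_distrib_left[symmetric] power2_diff sum.distrib sum_subtractf
    by (simp add: x_def sum_distrib_left[symmetric])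
  show mean: "(\<Sum>c = 1..k. dirichlet c) / k = e1 k"
    unfolding d1 e1 s1 x_def[symmetric] using x U0
    by (simp add: divide_simps) algebra
  have e2: "e2 k = - 2 * (6 + 11 * x - 3 * x\<^sup>2) / (x - 3)^3
     + 4 * (3 + 5 * x) / ((x - 3)^3 * (x + 1) * U)
     + 4 * (x + 3) * S / ((x - 3)^3 * U)
     + 8 * x * (S + 1) * C' / ((x - 3)^3 * U\<^sup>2)
     - 8 * x\<^sup>2 * C / ((x - 3)^3 * (x + 1) * U)"
    by (simp add: e2_def Let_def a_def[symmetric] S x_def U_def C_def C'_def
      Suc_eq_plus1[symmetric] del: Suc_eq_plus1)
  \<comment> \<open>Twice the average of the squares; subtracting the mean \<open>e1 k\<close> gives
    the claim. Denominators are cleared first, so that the relations enter only a polynomial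
    identity.\<close>
  have "2 * (x / (x - 3))\<^sup>2 * (x - 2 * (2 * s1 / U) + 2 * (s2 + p) / U\<^sup>2) / x = 2 * e1 k + e2 k"
  proof -
    have "(x - 3)^3 * (x + 1) * U\<^sup>2 * (2 * (x / (x - 3))\<^sup>2 * (x - 2 * (2 * s1 / U) + 2 * (s2 + p) / U\<^sup>2) / x)
       = 2 * x * ((x - 3) * (x + 1) * (x * U\<^sup>2) - 4 * (x + 1) * (U - S - 1) * U
          + 2 * ((U * C + C' * S - 1 - 2 * x) + ((x + 1) * C' * 2 - (x - 1) * U)))"
      unfolding s1 s2 p using x U0 by (simp add: divide_simps) algebra
    also have "\<dots> = 2 * (2 * (x - 3) * (x + 1) * U + 2 * S * (x - 3) * (x + 1) * U
          + (x\<^sup>2 - 3 * x - 2) * (x - 3) * (x + 1) * U\<^sup>2)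
        + (- 2 * (6 + 11 * x - 3 * x\<^sup>2) * (x + 1) * U\<^sup>2 + 4 * (3 + 5 * x) * U
          + 4 * (x + 3) * S * (x + 1) * U + 8 * x * (S + 1) * C' * (x + 1) - 8 * x\<^sup>2 * C * U)"
      using U C' pell by algebra
    also have "\<dots> = (x - 3)^3 * (x + 1) * U\<^sup>2 * (2 * e1 k + e2 k)"
      unfolding e1 e2 using x U0 by (simp add: divide_simps) algebra
    finally have "(x - 3)^3 * (x + 1) * U\<^sup>2 * (2 * (x / (x - 3))\<^sup>2 * (x - 2 * (2 * s1 / U) + 2 * (s2 + p) / U\<^sup>2) / x)
       = (x - 3)^3 * (x + 1) * U\<^sup>2 * (2 * e1 k + e2 k)" .
    moreover have "(x - 3)^3 * (x + 1) * U\<^sup>2 \<noteq> 0" using x U0 by simp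
    ultimately show ?thesis by (rule mult_left_cancel[THEN iffD1, rotated])
  qed
  then show "(\<Sum>c = 1..k. 2 * (dirichlet c)\<^sup>2 - dirichlet c) / k = e1 k + e2 k"
    using mean by (simp add: sum_subtractf sum_distrib_left[symmetric] diff_divide_distrib d2
      x_def[symmetric])
qed

lemma run_limits_e1_e2:
  "mean_of L_staircase_subword k \<longlonglongrightarrow> e1 k"
  "variance_of L_staircase_subword k \<longlonglongrightarrow> e1 k + e2 k - (e1 k)\<^sup>2"
  using run_limits_dirichlet[of k dirichlet] dirichlet_boundary dirichlet_rec k
  unfolding mean_limit square_limit by auto

end

subsection \<open>Staircase subsequences\<close>

fun chain :: "nat \<Rightarrow> nat list \<Rightarrow> nat" where
  "chain c [] = 0"
| "chain c (b # w) = (if near b c then Suc (chain b w) else chain c w)"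

lemma chain_eq_0: "(\<And>b. b \<in> set w \<Longrightarrow> \<not> near b c) \<Longrightarrow> chain c w = 0"
  by (induction w) auto

text \<open>Turns the letter-by-letter scan into a jump to the first near letter, which is how
  \<open>L_index\<close> proceeds.\<close>

lemma chain_first_near:
  "p < length w \<Longrightarrow> near (w ! p) c \<Longrightarrow> (\<And>i. i < p \<Longrightarrow> \<not> near (w ! i) c) \<Longrightarrow>
    chain c w = Suc (chain (w ! p) (drop (Suc p) w))"
proof (induction w arbitrary: p)
  case (Cons b w)
  show ?case
  proof (cases p)
    case 0
    then show ?thesis using Cons.prems by simp
  next
    case (Suc q)
    have "\<not> near b c" using Cons.prems(3)[of 0] Suc by simp
    moreover have "\<not> near (w ! i) c" if "i < q" for i
      using Cons.prems(3)[of "Suc i"] Suc that by simp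
    ultimately show ?thesis using Cons.IH[of q] Cons.prems Suc by simp
  qed
qed simp

text \<open>No \<open>enat m\<close> exceeds infinity, so the set of candidates stays empty.\<close>

lemma L_index_infinity: "L_index w (Suc j) = \<infinity> \<Longrightarrow> L_index w (Suc j + s) = \<infinity>"
  by (induction s) (simp_all add: top_enat_def)

text \<open>Stated for any step \<open>j\<close> located at position \<open>m\<close>, so that
  induction on the number of letters behind \<open>m\<close> can follow the jumps. Positions are
  1-based: \<open>drop m w\<close> starts right behind position \<open>m\<close>.\<close>

lemma L_index_finite_iff:
  assumes "L_index w (Suc j) = enat m" "m \<ge> 1" "m \<le> length w"
  shows "L_index w (Suc j + s) < \<infinity> \<longleftrightarrow> s \<le> chain (w ! (m - 1)) (drop m w)"
  using assms
proof (induction "length w - m" arbitrary: m j s rule: less_induct)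
  case less
  let ?c = "w ! (m - 1)"
  let ?A = "{enat m' |m'. enat m < enat m' \<and> m' \<le> length w \<and> \<bar>int (w ! (m' - 1)) - int ?c\<bar> \<le> 1}"
  have step: "L_index w (Suc (Suc j)) = Inf ?A"
    using less.prems(1) by simp
  show ?case
  proof (cases s)
    case 0
    then show ?thesis using less.prems(1) by simp
  next
    case (Suc s')
    show ?thesis
    proof (cases "\<exists>i < length (drop m w). near (drop m w ! i) ?c")
      case False
      have "?A = {}"
      proof -
        have False if "m < m'" "m' \<le> length w" "\<bar>int (w ! (m' - 1)) - int ?c\<bar> \<le> 1" for m'
        proof -
          have "m' - 1 - m < length (drop m w)" "drop m w ! (m' - 1 - m) = w ! (m' - 1)"
            using that by auto
          then show False using False that by (auto simp: near_def)
        qed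
        then show ?thesis by auto
      qed
      then have "L_index w (Suc (Suc j)) = \<infinity>"
        unfolding step \<open>?A = {}\<close> by (simp add: top_enat_def)
      then have "L_index w (Suc j + s) = \<infinity>"
        using L_index_infinity[of w "Suc j" s'] Suc by simp
      moreover have "chain ?c (drop m w) = 0"
        using False by (intro chain_eq_0) (auto simp: in_set_conv_nth)
      ultimately show ?thesis using Suc by simp
    next
      case True
      define p where "p = (LEAST i. i < length (drop m w) \<and> near (drop m w ! i) ?c)"
      have p: "p < length (drop m w)" "near (drop m w ! p) ?c"
        using LeastI_ex[OF True] by (auto simp: p_def)
      have least: "\<not> near (drop m w ! i) ?c" if "i < p" for i
        using not_less_Least[OF that[unfolded p_def]] less_trans[OF that p(1)] by blast
      \<comment> \<open>Offset \<open>p\<close> in \<open>drop m w\<close> is the 0-based index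
        \<open>m + p\<close> of \<open>w\<close>, hence the 1-based position
        \<open>m + p + 1\<close>.\<close>
      let ?m = "Suc (m + p)"
      have "Inf ?A = enat ?m"
      proof (rule antisym)
        show "Inf ?A \<le> enat ?m"
          using p by (intro Inf_lower) (auto simp: near_def)
        show "enat ?m \<le> Inf ?A"
        proof (rule Inf_greatest, safe)
          fix m' assume m': "enat m < enat m'" "m' \<le> length w" "\<bar>int (w ! (m' - 1)) - int ?c\<bar> \<le> 1"
          then have "drop m w ! (m' - 1 - m) = w ! (m' - 1)" by auto
          then have "\<not> m' - 1 - m < p" using least[of "m' - 1 - m"] m' by (auto simp: near_def)
          then show "enat ?m \<le> enat m'" using m' by auto
        qed
      qed
      then have "L_index w (Suc (Suc j)) = enat ?m" unfolding step .
      then have "L_index w (Suc (Suc j) + s') < \<infinity> \<longleftrightarrow> s' \<le> chain (w ! (?m - 1)) (drop ?m w)"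
        using p(1) by (intro less.hyps) auto
      moreover have "chain ?c (drop m w) = Suc (chain (w ! (?m - 1)) (drop ?m w))"
        using chain_first_near[OF p least] p(1) by (simp add: add.commute)
      ultimately show ?thesis using Suc by simp
    qed
  qed
qed

lemma L_staircase_subseq_eq_chain: "L_staircase_subseq (c # w) = Suc (chain c w)"
proof -
  have "L_index (c # w) r < \<infinity> \<longleftrightarrow> r \<le> Suc (chain c w)" for r
  proof (cases r)
    case (Suc s)
    then show ?thesis
      using L_index_finite_iff[of "c # w" 0 1 s] by (simp add: one_enat_def One_nat_def)
  qed simp
  then have "{r. L_index (c # w) r < \<infinity>} = {..Suc (chain c w)}" by auto
  then show ?thesis
    unfolding L_staircase_subseq_def by (auto intro: Max_eqI)
qed

lemma L_staircase_subseq_Nil: "L_staircase_subseq [] = 0"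
proof -
  have "L_index [] r < \<infinity> \<longleftrightarrow> r = 0" for r
    using L_index_infinity[of "[]" 0 "r - 1"] by (cases r) auto
  then show ?thesis by (simp add: L_staircase_subseq_def)
qed

lemma chain_le_length: "chain c w \<le> length w"
  by (induction c w rule: chain.induct) auto

lemma L_staircase_subseq_le_length: "L_staircase_subseq w \<le> length w"
  by (cases w) (simp_all add: L_staircase_subseq_Nil L_staircase_subseq_eq_chain chain_le_length)

text \<open>The current letter of the greedy subsequence performs the random walk with generator
  \<open>- (1 / k)\<close> times the Laplacian of the path; \<open>walk\<close> is its transition operator.\<close>

definition walk :: "nat \<Rightarrow> (nat \<Rightarrow> real) \<Rightarrow> nat \<Rightarrow> real" where
  "walk k F c = far k c * F c + nbsum k F c / real k"

definition chain_mean :: "nat \<Rightarrow> nat \<Rightarrow> nat \<Rightarrow> real" where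
  "chain_mean k n c = avg k n (\<lambda>w. real (chain c w))"

definition chain_square :: "nat \<Rightarrow> nat \<Rightarrow> nat \<Rightarrow> real" where
  "chain_square k n c = avg k n (\<lambda>w. (real (chain c w))\<^sup>2)"

lemma walk_diff: "walk k (\<lambda>b. F b - G b) c = walk k F c - walk k G c"
  by (simp add: walk_def nbsum_diff algebra_simps diff_divide_distrib)

lemma walk_add: "walk k (\<lambda>b. F b + G b) c = walk k F c + walk k G c"
  by (simp add: walk_def nbsum_add algebra_simps add_divide_distrib)

lemma sum_walk_commute:
  "(\<Sum>c = 1..k. F c * walk k G c) = (\<Sum>c = 1..k. walk k F c * G c)"
proof -
  have "(\<Sum>c = 1..k. F c * walk k G c)
      = (\<Sum>c = 1..k. F c * (far k c * G c)) + (\<Sum>c = 1..k. F c * nbsum k G c) / k"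
    by (simp add: walk_def distrib_left sum.distrib sum_divide_distrib)
  then show ?thesis
    unfolding sum_nbsum_commute
    by (simp add: walk_def algebra_simps sum.distrib sum_divide_distrib)
qed

lemma walk_const: "k > 0 \<Longrightarrow> walk k (\<lambda>_. x) c = x"
  using nbsum_cmult[of k x "\<lambda>_. 1" c] by (simp add: walk_def far_def field_simps)

text \<open>Stationarity of the uniform distribution: \<open>walk\<close> is symmetric and fixes
  constants.\<close>

lemma sum_walk: "k > 0 \<Longrightarrow> (\<Sum>c = 1..k. walk k F c) = (\<Sum>c = 1..k. F c)"
  using sum_walk_commute[where F = "\<lambda>_. 1" and G = F and k = k] by (simp add: walk_const)

text \<open>The weights of \<open>walk\<close> sum to 1 and are nonnegative, since
  \<open>k >= 3\<close> gives \<open>far k c >= 0\<close>.\<close>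

lemma abs_walk_le:
  assumes "k \<ge> 3" "c \<in> {1..k}" "\<And>b. b \<in> {1..k} \<Longrightarrow> \<bar>F b\<bar> \<le> B"
  shows "\<bar>walk k F c\<bar> \<le> B"
proof -
  have far: "far k c \<ge> 0" using assms by (auto simp: far_def nbsum_one)
  have "\<bar>walk k F c\<bar> \<le> far k c * \<bar>F c\<bar> + nbsum k (\<lambda>b. \<bar>F b\<bar>) c / k"
    unfolding walk_def
    by (rule order_trans[OF abs_triangle_ineq]) (simp add: abs_mult far abs_nbsum_le divide_right_mono)
  also have "\<dots> \<le> far k c * B + nbsum k (\<lambda>b. B) c / k"
    using assms far unfolding nbsum_def
    by (intro add_mono mult_left_mono divide_right_mono sum_mono) auto
  also have "\<dots> = B" using walk_const[of k B c] assms(1) by (simp add: walk_def)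
  finally show ?thesis .
qed

lemma chain_mean_Suc:
  assumes "k > 0"
  shows "chain_mean k (Suc n) c = nbsum k (\<lambda>_. 1) c / k + walk k (chain_mean k n) c"
proof -
  have "avg k n (\<lambda>w. real (chain c (b # w)))
      = of_bool (near b c) * (1 + chain_mean k n b) + of_bool (\<not> near b c) * chain_mean k n c" for b
    using assms by (cases "near b c") (simp_all add: chain_mean_def avg_add_const)
  then have "chain_mean k (Suc n) c = (nbsum k (\<lambda>b. 1 + chain_mean k n b) c
      + (\<Sum>b = 1..k. of_bool (\<not> near b c)) * chain_mean k n c) / k"
    by (simp add: chain_mean_def[of k "Suc n"] avg_Suc nbsum_def sum.distrib sum_distrib_right)
  then show ?thesis
    using assms by (simp add: sum_not_near_eq_far walk_def nbsum_add add_divide_distrib)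
qed

lemma chain_square_Suc:
  assumes "k > 0"
  shows "chain_square k (Suc n) c
    = nbsum k (\<lambda>b. 1 + 2 * chain_mean k n b) c / k + walk k (chain_square k n) c"
proof -
  have "avg k n (\<lambda>w. (real (chain c (b # w)))\<^sup>2)
      = of_bool (near b c) * ((1 + 2 * chain_mean k n b) + chain_square k n b)
        + of_bool (\<not> near b c) * chain_square k n c" for b
    using assms avg_square_add_const[OF assms, of n 1 "\<lambda>w. real (chain b w)"]
    by (cases "near b c") (simp_all add: chain_mean_def chain_square_def add.commute)
  then have "chain_square k (Suc n) c
    = (nbsum k (\<lambda>b. (1 + 2 * chain_mean k n b) + chain_square k n b) c
      + (\<Sum>b = 1..k. of_bool (\<not> near b c)) * chain_square k n c) / k"
    by (simp add: chain_square_def[of k "Suc n"] avg_Suc nbsum_def sum.distrib sum_distrib_right)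
  then show ?thesis
    using assms
    by (simp only: nbsum_add[where F = "\<lambda>b. 1 + 2 * chain_mean k n b"])
      (simp add: sum_not_near_eq_far walk_def add_divide_distrib)
qed

section \<open>Poisson equation and asymptotic variance of the subsequence length\<close>

context
  fixes k :: nat
  assumes k: "k \<ge> 3"
begin

definition rate :: real where
  "rate = (3 * real k - 2) / (real k)\<^sup>2"

definition excess :: "nat \<Rightarrow> real" where
  "excess c = nbsum k (\<lambda>_. 1) c / k - rate"

text \<open>The interior value of \<open>excess\<close> is \<open>2 / k^2\<close>, and one step of
  the walk adds \<open>1 / k\<close> times the second difference; so the latter must be
  \<open>- 2 / k\<close>. The centre is the midpoint of the path.\<close>

definition corrector :: "nat \<Rightarrow> real" where
  "corrector c = - ((real c - (real k + 1) / 2)\<^sup>2 / k)"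

lemma sum_nbsum_one: "(\<Sum>c = 1..k. nbsum k (\<lambda>_. 1) c) = (real k)\<^sup>2 * rate"
proof -
  have "(\<Sum>c = 1..k. nbsum k (\<lambda>_. 1) c) = (\<Sum>c = 1..k. if c = 1 \<or> c = k then 2 else 3)"
    using k by (intro sum.cong) (auto simp: nbsum_one)
  then show ?thesis
    using k sum_boundary_interior[of k 2 3] by (simp add: rate_def)
qed

lemma sum_excess: "(\<Sum>c = 1..k. excess c) = 0"
  using k sum_nbsum_one
  by (simp add: excess_def sum_subtractf sum_divide_distrib[symmetric] power2_eq_square)

text \<open>The Poisson equation: the excess is constant in the interior, so its solution is a parabola,
  and the boundary values fit.\<close>

lemma corrector_minus_walk:
  assumes "c \<in> {1..k}"
  shows "corrector c - walk k corrector c = excess c"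
proof -
  define x where "x = real k"
  define q where "q y = - ((y - (x + 1) / 2)\<^sup>2 / x)" for y
  have x: "x \<noteq> 0" using k by (simp add: x_def)
  have left: "q 1 - ((1 - 2 / x) * q 1 + (q 1 + q 2) / x) = 2 / x - (3 * x - 2) / x\<^sup>2"
    and right: "q x - ((1 - 2 / x) * q x + (q (x - 1) + q x) / x) = 2 / x - (3 * x - 2) / x\<^sup>2"
    and interior: "q y - ((1 - 3 / x) * q y + (q (y - 1) + q y + q (y + 1)) / x)
      = 3 / x - (3 * x - 2) / x\<^sup>2" for y
    using x by (simp_all add: q_def field_simps power2_eq_square)
  have "corrector b = q (real b)" for b by (simp add: corrector_def q_def x_def)
  then show ?thesis
    using k assms left right interior[of "real c"]
    by (auto simp: walk_def far_def nbsum_eq nbsum_one excess_def rate_def x_def[symmetric] of_nat_diff)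
qed

definition remainder :: "nat \<Rightarrow> nat \<Rightarrow> real" where
  "remainder n c = chain_mean k n c - (rate * real n + corrector c)"

text \<open>The Poisson equation cancels the source term of the mean recursion.\<close>

lemma remainder_Suc:
  assumes "c \<in> {1..k}"
  shows "remainder (Suc n) c = walk k (remainder n) c"
proof -
  have "remainder n = (\<lambda>c. chain_mean k n c - (rate * real n + corrector c))"
    by (simp add: fun_eq_iff remainder_def)
  then have "walk k (remainder n) c = walk k (chain_mean k n) c - (rate * real n + walk k corrector c)"
    using k by (simp add: walk_diff walk_add walk_const)
  then show ?thesis
    using k corrector_minus_walk[OF assms]
    by (simp add: remainder_def[of "Suc n"] chain_mean_Suc excess_def algebra_simps)
qed

text \<open>The initial remainder is \<open>- corrector\<close>, and \<open>walk\<close> does not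
  increase the maximum norm.\<close>

lemma abs_remainder_le:
  "c \<in> {1..k} \<Longrightarrow> \<bar>remainder n c\<bar> \<le> (\<Sum>b = 1..k. \<bar>corrector b\<bar>)"
proof (induction n arbitrary: c)
  case 0
  then show ?case
    by (simp add: remainder_def chain_mean_def avg_0 member_le_sum[of c _ "\<lambda>b. \<bar>corrector b\<bar>"])
next
  case (Suc n)
  then show ?case unfolding remainder_Suc[OF Suc.prems] by (intro abs_walk_le k)
qed

lemma sum_chain_mean: "(\<Sum>c = 1..k. chain_mean k n c) = real k * rate * real n"
proof (induction n)
  case 0
  then show ?case by (simp add: chain_mean_def avg_0)
next
  case (Suc n)
  then show ?case
    using k
    by (simp add: chain_mean_Suc sum.distrib sum_walk sum_divide_distrib[symmetric] sum_nbsum_one)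
      (simp add: field_simps power2_eq_square)
qed

text \<open>Variance per letter: \<open>rate - rate^2\<close> for a single selection indicator, plus
  twice the covariances with all later ones, which the corrector sums up.\<close>

definition slope :: real where
  "slope = rate - rate\<^sup>2 + 2 / k * (\<Sum>c = 1..k. excess c * corrector c)"

text \<open>The linear part drops out because \<open>excess\<close> sums to zero. In the rest
  \<open>excess\<close> is \<open>corrector\<close> minus its walk, and symmetry lets the walk
  advance \<open>remainder\<close> by one step.\<close>

lemma sum_excess_chain_mean:
  "(\<Sum>c = 1..k. excess c * chain_mean k n c) = (\<Sum>c = 1..k. excess c * corrector c)
    + (\<Sum>c = 1..k. corrector c * remainder n c) - (\<Sum>c = 1..k. corrector c * remainder (Suc n) c)"
proof -
  have "(\<Sum>c = 1..k. excess c * chain_mean k n c)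
      = (\<Sum>c = 1..k. rate * real n * excess c + excess c * corrector c + excess c * remainder n c)"
    by (simp add: remainder_def algebra_simps)
  also have "\<dots> = (\<Sum>c = 1..k. excess c * corrector c) + (\<Sum>c = 1..k. excess c * remainder n c)"
    by (simp add: sum.distrib sum_distrib_left[symmetric] sum_excess)
  also have "(\<Sum>c = 1..k. excess c * remainder n c)
      = (\<Sum>c = 1..k. corrector c * remainder n c) - (\<Sum>c = 1..k. walk k corrector c * remainder n c)"
    by (simp add: corrector_minus_walk[symmetric] left_diff_distrib sum_subtractf)
  also have "(\<Sum>c = 1..k. walk k corrector c * remainder n c)
      = (\<Sum>c = 1..k. corrector c * remainder (Suc n) c)"
    unfolding sum_walk_commute[symmetric] by (simp add: remainder_Suc)
  finally show ?thesis by simp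
qed

text \<open>Every step adds \<open>slope\<close> plus a difference of consecutive pairings of
  \<open>corrector\<close> with \<open>remainder\<close>, so the deviation telescopes.\<close>

lemma sum_chain_square:
  "(\<Sum>c = 1..k. chain_square k n c) / k - (rate * n)\<^sup>2
    = slope * n + 2 / k * ((\<Sum>c = 1..k. corrector c * remainder 0 c)
        - (\<Sum>c = 1..k. corrector c * remainder n c))"
proof (induction n)
  case 0
  then show ?case by (simp add: chain_square_def avg_0)
next
  case (Suc n)
  have "(\<Sum>c = 1..k. nbsum k (\<lambda>b. 1 + 2 * chain_mean k n b) c)
      = (\<Sum>c = 1..k. nbsum k (\<lambda>_. 1) c * (1 + 2 * chain_mean k n c))"
    using sum_nbsum_commute[where F = "\<lambda>_. 1" and k = k] by simp
  also have "\<dots> = (\<Sum>c = 1..k. nbsum k (\<lambda>_. 1) c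
      + 2 * k * (excess c * chain_mean k n c + rate * chain_mean k n c))"
    using k by (simp add: excess_def algebra_simps)
  also have "\<dots> = (real k)\<^sup>2 * rate + 2 * k * ((\<Sum>c = 1..k. excess c * chain_mean k n c) + k * rate\<^sup>2 * n)"
    by (simp add: sum.distrib sum_distrib_left[symmetric] sum_nbsum_one sum_chain_mean
      power2_eq_square)
  finally have sum: "(\<Sum>c = 1..k. nbsum k (\<lambda>b. 1 + 2 * chain_mean k n b) c) = \<dots>" .
  have "(\<Sum>c = 1..k. chain_square k (Suc n) c) / k
      = rate + 2 / k * (\<Sum>c = 1..k. excess c * chain_mean k n c) + 2 * rate\<^sup>2 * n
        + (\<Sum>c = 1..k. chain_square k n c) / k"
    using k by (simp add: chain_square_Suc sum.distrib sum_walk sum_divide_distrib[symmetric] sum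
      add_divide_distrib distrib_left power2_eq_square)
  then show ?case
    using Suc.IH unfolding sum_excess_chain_mean slope_def of_nat_Suc
    by (simp add: algebra_simps power2_eq_square add_divide_distrib)
qed

lemma mean_L_staircase_subseq:
  "mean_of L_staircase_subseq k (Suc n) = 1 + rate * n"
  using k by (subst mean_variance_Suc(1)[where Y = "\<lambda>c w. 1 + real (chain c w)"])
    (simp_all add: L_staircase_subseq_eq_chain avg_add_const sum.distrib
      chain_mean_def[symmetric] sum_chain_mean add_divide_distrib)

lemma variance_L_staircase_subseq:
  "\<exists>B. \<forall>n. \<bar>variance_of L_staircase_subseq k (Suc n) - slope * n\<bar> \<le> B"
proof -
  let ?b = "\<lambda>n. \<Sum>c = 1..k. corrector c * remainder n c"
  define C where "C = (\<Sum>c = 1..k. \<bar>corrector c\<bar>)"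
  have bound: "\<bar>?b n\<bar> \<le> C * C" for n
  proof -
    have "\<bar>?b n\<bar> \<le> (\<Sum>c = 1..k. \<bar>corrector c * remainder n c\<bar>)" by (rule sum_abs)
    also have "\<dots> \<le> (\<Sum>c = 1..k. \<bar>corrector c\<bar> * C)"
      unfolding abs_mult C_def by (intro sum_mono mult_left_mono abs_remainder_le) auto
    finally show ?thesis by (simp add: sum_distrib_right[symmetric] C_def)
  qed
  have "\<bar>variance_of L_staircase_subseq k (Suc n) - slope * n\<bar> \<le> 2 / k * (2 * (C * C))" for n
  proof -
    have "variance_of L_staircase_subseq k (Suc n)
        = (\<Sum>c = 1..k. 1 + 2 * chain_mean k n c + chain_square k n c) / k - (1 + rate * n)\<^sup>2"
      using k by (subst mean_variance_Suc(2)[where Y = "\<lambda>c w. 1 + real (chain c w)"])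
        (simp_all add: L_staircase_subseq_eq_chain avg_square_add_const chain_mean_def
          chain_square_def mean_L_staircase_subseq)
    also have "\<dots> = (\<Sum>c = 1..k. chain_square k n c) / k - (rate * n)\<^sup>2"
      using k by (simp add: sum.distrib sum_distrib_left[symmetric] sum_chain_mean
        add_divide_distrib power2_eq_square algebra_simps)
    finally have "variance_of L_staircase_subseq k (Suc n) - slope * n = 2 / k * (?b 0 - ?b n)"
      by (simp add: sum_chain_square)
    also have "\<bar>\<dots>\<bar> = 2 / k * \<bar>?b 0 - ?b n\<bar>" by (simp only: abs_mult) simp
    also have "\<dots> \<le> 2 / k * (2 * (C * C))"
      using bound[of 0] bound[of n] by (intro mult_left_mono) auto
    finally show ?thesis .
  qed
  then show ?thesis by blast
qed

end

subsection \<open>The generating function of the subsequence length\<close>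

text \<open>Differentiating the geometric series twice gives the coefficients
  \<open>(n + 1) * (n + 2)\<close>, which dominate \<open>n^2\<close>.\<close>

lemma summable_square_power:
  fixes y :: real
  assumes "0 \<le> y" "y < 1"
  shows "summable (\<lambda>n. (real n)\<^sup>2 * y ^ n)"
proof -
  have geometric: "summable (\<lambda>n. 1 * z ^ n)" if "norm z < 1" for z :: real
    using that by (simp add: summable_geometric)
  have diffs1: "summable (\<lambda>n. diffs (\<lambda>_. 1) n * z ^ n)" if "norm z < 1" for z :: real
    using termdiff_converges[OF that geometric] .
  have "summable (\<lambda>n. diffs (diffs (\<lambda>_. 1)) n * y ^ n)"
    using termdiff_converges[of y 1, OF _ diffs1] assms by simp
  then show ?thesis
  proof (rule summable_comparison_test[rotated], intro exI allI impI)
    fix n :: nat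
    have "(real n)\<^sup>2 * y ^ n \<le> (real n + 1) * (real n + 2) * y ^ n"
      using assms by (intro mult_right_mono) (simp_all add: power2_eq_square algebra_simps)
    then show "norm ((real n)\<^sup>2 * y ^ n) \<le> diffs (diffs (\<lambda>_. 1)) n * y ^ n"
      using assms by (simp add: diffs_def algebra_simps)
  qed
qed

lemma sums_square_power:
  fixes y :: real
  assumes "0 \<le> y" "y < 1"
  shows "(\<lambda>n. real n * y ^ n) sums (y / (1 - y)\<^sup>2)"
    and "(\<lambda>n. (real n)\<^sup>2 * y ^ n) sums (y * (1 + y) / (1 - y) ^ 3)"
proof -
  have "(\<lambda>n. y * (real (Suc n) * y ^ n)) sums (y * (1 / (1 - y)\<^sup>2))"
    using geometric_deriv_sums[of y] assms by (intro sums_mult) simp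
  then have "(\<lambda>n. real (Suc n) * y ^ Suc n) sums (y / (1 - y)\<^sup>2)"
    by (simp add: mult_ac)
  then show first: "(\<lambda>n. real n * y ^ n) sums (y / (1 - y)\<^sup>2)"
    using sums_Suc_iff[of "\<lambda>n. real n * y ^ n"] by simp
  define s where "s = (\<Sum>n. (real n)\<^sup>2 * y ^ n)"
  have s: "(\<lambda>n. (real n)\<^sup>2 * y ^ n) sums s"
    using summable_square_power[OF assms] by (simp add: s_def summable_sums)
  \<comment> \<open>Expanding \<open>(n + 1)^2\<close> relates the shifted series to the original
    one and yields a linear equation for \<open>s\<close>.\<close>
  have "(\<lambda>n. y * ((real n)\<^sup>2 * y ^ n + 2 * (real n * y ^ n) + y ^ n))
      sums (y * (s + 2 * (y / (1 - y)\<^sup>2) + 1 / (1 - y)))"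
    using assms by (intro sums_mult sums_add s first geometric_sums) simp
  then have "(\<lambda>n. (real (Suc n))\<^sup>2 * y ^ Suc n) sums (y * (s + 2 * (y / (1 - y)\<^sup>2) + 1 / (1 - y)))"
    by (simp add: power2_eq_square algebra_simps)
  then have "s = y * (s + 2 * (y / (1 - y)\<^sup>2) + 1 / (1 - y))"
    using s sums_Suc_iff[of "\<lambda>n. (real n)\<^sup>2 * y ^ n"] sums_unique2 by fastforce
  then have "s * (1 - y) = y * (2 * (y / (1 - y)\<^sup>2) + 1 / (1 - y))" by algebra
  then have "s = y * (2 * (y / (1 - y)\<^sup>2) + 1 / (1 - y)) / (1 - y)"
    using assms by (simp add: eq_divide_eq)
  also have "\<dots> = y * (1 + y) / (1 - y) ^ 3"
    using assms by (simp add: divide_simps) algebra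
  finally show "(\<lambda>n. (real n)\<^sup>2 * y ^ n) sums (y * (1 + y) / (1 - y) ^ 3)"
    using s by simp
qed

lemma abs_sum_words_le:
  assumes "x \<ge> 0" "\<And>w. w \<in> words k n \<Longrightarrow> \<bar>F w\<bar> \<le> C"
  shows "\<bar>(\<Sum>w \<in> words k n. F w) * x ^ n\<bar> \<le> C * (real k * x) ^ n"
proof -
  have "\<bar>\<Sum>w \<in> words k n. F w\<bar> \<le> (\<Sum>w \<in> words k n. C)"
    by (rule order_trans[OF sum_abs sum_mono]) (rule assms(2))
  then have "\<bar>\<Sum>w \<in> words k n. F w\<bar> * x ^ n \<le> (real k ^ n * C) * x ^ n"
    using assms(1) by (intro mult_right_mono) (simp_all add: card_words)
  then show ?thesis using assms(1) by (simp add: abs_mult power_mult_distrib mult_ac)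
qed

text \<open>Termwise differentiation near \<open>q = 1\<close>. As the statistic is at most
  \<open>n\<close>, the terms and their first two derivatives are dominated by \<open>z^n\<close>,
  \<open>n * z^n\<close> and \<open>n^2 * z^n\<close>.\<close>

lemma deriv_L_gf:
  assumes x: "0 < x" "real k * x < 1" and "k > 0"
  shows "(deriv ^^ 2) (L_gf k x) 1 =
    (\<Sum>n. avg k n (\<lambda>w. real (L_staircase_subseq w) * (real (L_staircase_subseq w) - 1)) * (real k * x) ^ n)"
proof -
  let ?J = L_staircase_subseq
  define y where "y = real k * x"
  have y: "0 < y" "y < 1" using assms by (simp_all add: y_def)
  \<comment> \<open>The midpoint of \<open>1\<close> and \<open>1 / y\<close>: the interval of
    radius \<open>\<rho>\<close> contains \<open>1\<close>, while \<open>\<rho> * y\<close> stays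
    below 1.\<close>
  define \<rho> where "\<rho> = (1 + 1 / y) / 2"
  have \<rho>: "\<rho> > 1" "\<rho> * y = (1 + y) / 2" using y by (simp_all add: \<rho>_def field_simps)
  define z where "z = (1 + y) / 2"
  have z: "0 \<le> z" "z < 1" using y by (simp_all add: z_def)
  define t where "t n q = (\<Sum>w \<in> words k n. q ^ ?J w) * x ^ n" for n and q :: real
  define t' where "t' n q = (\<Sum>w \<in> words k n. real (?J w) * q ^ (?J w - 1)) * x ^ n" for n and q :: real
  define t'' where "t'' n q = (\<Sum>w \<in> words k n. real (?J w) * (real (?J w - 1) * q ^ (?J w - 1 - 1))) * x ^ n"
    for n and q :: real
  have power: "\<bar>q\<bar> ^ e \<le> \<rho> ^ n" if "q \<in> ball 0 \<rho>" "e \<le> n" for q :: real and e n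
  proof -
    have "\<bar>q\<bar> ^ e \<le> \<rho> ^ e" using that by (intro power_mono) auto
    also have "\<dots> \<le> \<rho> ^ n" using that \<rho> by (intro power_increasing) auto
    finally show ?thesis .
  qed
  have J: "?J w \<le> n" if "w \<in> words k n" for w n
    using that L_staircase_subseq_le_length[of w] by (simp add: words_def)
  have yz: "C * \<rho> ^ n * (real k * x) ^ n = C * z ^ n" for C n
    unfolding y_def[symmetric] z_def \<rho>(2)[symmetric] by (simp add: power_mult_distrib)
  have bound0: "norm (t n q) \<le> z ^ n" if "q \<in> ball 0 \<rho>" for n q
    using abs_sum_words_le[of x k n "\<lambda>w. q ^ ?J w" "1 * \<rho> ^ n"] power[OF that J] x
    unfolding yz by (simp add: t_def power_abs)
  have bound1: "norm (t' n q) \<le> real n * z ^ n" if "q \<in> ball 0 \<rho>" for n q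
    unfolding t'_def real_norm_def yz[symmetric]
  proof (rule abs_sum_words_le)
    fix w assume w: "w \<in> words k n"
    show "\<bar>real (?J w) * q ^ (?J w - 1)\<bar> \<le> real n * \<rho> ^ n"
      unfolding abs_mult power_abs using J[OF w] by (intro mult_mono power that) auto
  qed (use x in simp)
  have bound2: "norm (t'' n q) \<le> (real n)\<^sup>2 * z ^ n" if "q \<in> ball 0 \<rho>" for n q
    unfolding t''_def real_norm_def yz[symmetric]
  proof (rule abs_sum_words_le)
    fix w assume w: "w \<in> words k n"
    show "\<bar>real (?J w) * (real (?J w - 1) * q ^ (?J w - 1 - 1))\<bar> \<le> (real n)\<^sup>2 * \<rho> ^ n"
      unfolding abs_mult power_abs power2_eq_square mult.assoc
      using J[OF w] by (intro mult_mono power that) auto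
  qed (use x in simp)
  have summable1: "summable (\<lambda>n. real n * z ^ n)"
    using sums_square_power(1)[OF z] by (rule sums_summable)
  have uniform1: "uniformly_convergent_on (ball 0 \<rho>) (\<lambda>n q. \<Sum>i<n. t' i q)"
    using bound1 summable1 by (rule Weierstrass_m_test')
  have uniform2: "uniformly_convergent_on (ball 0 \<rho>) (\<lambda>n q. \<Sum>i<n. t'' i q)"
    using bound2 summable_square_power[OF z] by (rule Weierstrass_m_test')
  have one: "1 \<in> ball (0::real) \<rho>" using \<rho> by simp
  have summable_t: "summable (\<lambda>n. t n 1)"
    using bound0[OF one] z by (intro summable_comparison_test'[OF summable_geometric[of z]]) auto
  have summable_t': "summable (\<lambda>n. t' n 1)"
    using bound1[OF one] by (intro summable_comparison_test'[OF summable1]) auto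
  have deriv1: "deriv (L_gf k x) q = (\<Sum>n. t' n q)" if "q \<in> ball 0 \<rho>" for q
  proof (rule DERIV_imp_deriv)
    have "((\<lambda>q. \<Sum>n. t n q) has_field_derivative (\<Sum>n. t' n q)) (at q)"
    proof (rule has_field_derivative_series'(2)[where f = t and f' = t', OF convex_ball _ uniform1 one summable_t])
      fix n q show "(t n has_field_derivative t' n q) (at q within ball 0 \<rho>)"
        unfolding t_def t'_def by (auto intro!: derivative_eq_intros sum.cong simp: One_nat_def)
    qed (use that in simp)
    then show "(L_gf k x has_field_derivative (\<Sum>n. t' n q)) (at q)"
      by (simp add: L_gf_def[abs_def] t_def)
  qed
  have "((\<lambda>q. \<Sum>n. t' n q) has_field_derivative (\<Sum>n. t'' n 1)) (at 1)"
  proof (rule has_field_derivative_series'(2)[where f = t' and f' = t'', OF convex_ball _ uniform2 one summable_t'])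
    fix n q show "(t' n has_field_derivative t'' n q) (at q within ball 0 \<rho>)"
      unfolding t'_def t''_def by (auto intro!: derivative_eq_intros sum.cong simp: One_nat_def)
  qed (use one in simp)
  moreover have "eventually (\<lambda>q. deriv (L_gf k x) q = (\<Sum>n. t' n q)) (nhds 1)"
    using eventually_nhds_in_open[OF open_ball one] by eventually_elim (rule deriv1)
  ultimately have "(deriv ^^ 2) (L_gf k x) 1 = (\<Sum>n. t'' n 1)"
    by (simp add: numeral_2_eq_2 deriv_cong_ev DERIV_imp_deriv)
  moreover have "t'' n 1 = avg k n (\<lambda>w. real (?J w) * (real (?J w) - 1)) * (real k * x) ^ n" for n
  proof -
    \<comment> \<open>The truncated difference is harmless: at \<open>m = 0\<close> the other factor
      vanishes.\<close>
    have falling: "real m * real (m - 1) = real m * (real m - 1)" for m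
      by (cases m) auto
    show ?thesis
      unfolding t''_def avg_def power_one mult_1_right falling
      using \<open>k > 0\<close> by (simp add: power_mult_distrib)
  qed
  ultimately show ?thesis by simp
qed

section \<open>The limit \<open>a\<close> and its relation to the variance\<close>

context
  fixes k :: nat
  assumes k: "k \<ge> 3"
begin

text \<open>The polynomial of \<open>a_fun_approx\<close> at \<open>y = 1\<close>.\<close>

definition subseq_limit :: real where
  "subseq_limit = slope k + rate k - 5 * (rate k)\<^sup>2"

text \<open>A quadratic polynomial in \<open>n\<close> plus a term that stays bounded.\<close>

lemma factorial_moment_L_staircase_subseq:
  "avg k (Suc n) (\<lambda>w. real (L_staircase_subseq w) * (real (L_staircase_subseq w) - 1))
    = (rate k)\<^sup>2 * (real n)\<^sup>2 + (rate k + slope k) * n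
      + (variance_of L_staircase_subseq k (Suc n) - slope k * n)"
proof -
  let ?J = "\<lambda>w. real (L_staircase_subseq w)"
  have "avg k (Suc n) (\<lambda>w. ?J w * (?J w - 1)) = avg k (Suc n) (\<lambda>w. (?J w)\<^sup>2 + (- 1) * ?J w)"
    by (simp add: power2_eq_square algebra_simps)
  also have "\<dots> = avg k (Suc n) (\<lambda>w. (?J w)\<^sup>2) - mean_of L_staircase_subseq k (Suc n)"
    using k by (simp only: avg_add avg_cmult) (simp add: mean_of_eq_avg)
  also have "avg k (Suc n) (\<lambda>w. (?J w)\<^sup>2)
      = variance_of L_staircase_subseq k (Suc n) + (mean_of L_staircase_subseq k (Suc n))\<^sup>2"
    using k by (simp add: variance_of_eq_avg mean_of_eq_avg)
  finally show ?thesis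
    using mean_L_staircase_subseq[OF k, of n] by (simp add: power2_eq_square algebra_simps)
qed

text \<open>The subtracted term cancels the triple pole, since \<open>y^3 + y^2 - 2\<close> is
  divisible by \<open>y - 1\<close>; the factor \<open>(1 - y)^2\<close> removes the remaining
  double pole. The bounded part has a series of size at most \<open>B / (1 - y)\<close>.\<close>

lemma a_fun_approx:
  assumes B: "\<And>n. \<bar>variance_of L_staircase_subseq k (Suc n) - slope k * n\<bar> \<le> B"
    and x: "0 < x" "real k * x < 1"
  defines "y \<equiv> real k * x"
  shows "\<bar>a_fun k x - ((rate k + slope k) * y\<^sup>2 - (rate k)\<^sup>2 * (y\<^sup>2 + 2 * y + 2))\<bar> \<le> B * (1 - y)"
proof -
  define b where "b n = variance_of L_staircase_subseq k (Suc n) - slope k * n" for n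
  define F where "F n = avg k n (\<lambda>w. real (L_staircase_subseq w) * (real (L_staircase_subseq w) - 1))" for n
  define p c where "p = rate k" and "c = rate k + slope k"
  have y: "0 < y" "y < 1" using x k by (simp_all add: y_def)
  have b: "norm (b n * y ^ n) \<le> B * y ^ n" for n
    using B[of n] y by (simp add: b_def abs_mult mult_right_mono)
  have By: "(\<lambda>n. B * y ^ n) sums (B * (1 / (1 - y)))"
    using y by (intro sums_mult geometric_sums) simp
  have summable_norm_b: "summable (\<lambda>n. norm (b n * y ^ n))"
    using b by (intro summable_comparison_test'[OF sums_summable[OF By]]) simp
  then have summable_b: "summable (\<lambda>n. b n * y ^ n)" by (rule summable_norm_cancel)
  define S where "S = (\<Sum>n. b n * y ^ n)"
  have "\<bar>S\<bar> \<le> (\<Sum>n. norm (b n * y ^ n))"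
    using summable_norm[OF summable_norm_b] by (simp add: S_def)
  also have "\<dots> \<le> (\<Sum>n. B * y ^ n)"
    by (rule suminf_le[OF b summable_norm_b sums_summable[OF By]])
  also have "\<dots> = B / (1 - y)" using sums_unique[OF By] by simp
  finally have S: "\<bar>S\<bar> \<le> B / (1 - y)" .
  have "(\<lambda>n. y * (p\<^sup>2 * ((real n)\<^sup>2 * y ^ n) + c * (real n * y ^ n) + b n * y ^ n))
      sums (y * (p\<^sup>2 * (y * (1 + y) / (1 - y) ^ 3) + c * (y / (1 - y)\<^sup>2) + S))"
    using y summable_b unfolding S_def
    by (intro sums_mult sums_add sums_square_power summable_sums) auto
  then have "(\<lambda>n. F (Suc n) * y ^ Suc n)
      sums (y * (p\<^sup>2 * (y * (1 + y) / (1 - y) ^ 3) + c * (y / (1 - y)\<^sup>2) + S))"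
    unfolding F_def factorial_moment_L_staircase_subseq
    by (simp add: b_def p_def c_def algebra_simps)
  moreover have "F 0 = 0" by (simp add: F_def avg_0 L_staircase_subseq_Nil)
  ultimately have "(\<lambda>n. F n * y ^ n)
      sums (y * (p\<^sup>2 * (y * (1 + y) / (1 - y) ^ 3) + c * (y / (1 - y)\<^sup>2) + S))"
    using sums_Suc_iff[of "\<lambda>n. F n * y ^ n"] by simp
  then have second: "(deriv ^^ 2) (L_gf k x) 1
      = y * (p\<^sup>2 * (y * (1 + y) / (1 - y) ^ 3) + c * (y / (1 - y)\<^sup>2) + S)"
    using deriv_L_gf[of x k] x k unfolding F_def y_def by (simp add: sums_iff)
  have rate: "2 * (3 * real k - 2)\<^sup>2 / (real k ^ 4 * (1 - y) ^ 3) = 2 * p\<^sup>2 / (1 - y) ^ 3"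
    by (simp add: p_def rate_def[OF k] power_divide flip: power_mult)
  have "a_fun k x = c * y\<^sup>2 - p\<^sup>2 * (y\<^sup>2 + 2 * y + 2) + y * (1 - y)\<^sup>2 * S"
    unfolding a_fun_def second y_def[symmetric] rate using y
    by (simp add: divide_simps) algebra
  then have "\<bar>a_fun k x - (c * y\<^sup>2 - p\<^sup>2 * (y\<^sup>2 + 2 * y + 2))\<bar> = y * (1 - y)\<^sup>2 * \<bar>S\<bar>"
    using y by (simp add: abs_mult)
  also have "\<dots> \<le> 1 * (1 - y)\<^sup>2 * (B / (1 - y))"
    using y S by (intro mult_mono) auto
  also have "\<dots> = B * (1 - y)" using y by (simp add: power2_eq_square)
  finally show ?thesis by (simp add: p_def c_def)
qed

text \<open>The limit is taken from the left because the series of \<open>L_gf\<close> at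
  \<open>q = 1\<close> diverges for \<open>k * x >= 1\<close>.\<close>

lemma a_fun_tendsto: "(a_fun k \<longlongrightarrow> subseq_limit) (at_left (1 / real k))"
proof -
  obtain B where B: "\<And>n. \<bar>variance_of L_staircase_subseq k (Suc n) - slope k * n\<bar> \<le> B"
    using variance_L_staircase_subseq[OF k] by blast
  define m where "m x = (rate k + slope k) * (real k * x)\<^sup>2
    - (rate k)\<^sup>2 * ((real k * x)\<^sup>2 + 2 * (real k * x) + 2)" for x
  have id: "((\<lambda>x. x) \<longlongrightarrow> 1 / real k) (at_left (1 / real k))"
    by (rule tendsto_ident_at)
  have "((\<lambda>x. a_fun k x - m x) \<longlongrightarrow> 0) (at_left (1 / real k))"
  proof (rule Lim_null_comparison)
    have "eventually (\<lambda>x. x \<in> {0<..<1 / real k}) (at_left (1 / real k))"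
      using k by (intro eventually_at_left_real) simp
    then show "eventually (\<lambda>x. norm (a_fun k x - m x) \<le> B * (1 - real k * x)) (at_left (1 / real k))"
    proof eventually_elim
      case (elim x)
      then have "0 < x" "real k * x < 1" using k by (auto simp: field_simps)
      then show ?case using a_fun_approx[OF B] by (simp add: m_def)
    qed
    have "((\<lambda>x. B * (1 - real k * x)) \<longlongrightarrow> B * (1 - real k * (1 / real k))) (at_left (1 / real k))"
      by (intro tendsto_intros id)
    then show "((\<lambda>x. B * (1 - real k * x)) \<longlongrightarrow> 0) (at_left (1 / real k))" using k by simp
  qed
  moreover have "(m \<longlongrightarrow> m (1 / real k)) (at_left (1 / real k))"
    unfolding m_def by (intro tendsto_intros id)
  ultimately have "((\<lambda>x. (a_fun k x - m x) + m x) \<longlongrightarrow> 0 + m (1 / real k)) (at_left (1 / real k))"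
    by (rule tendsto_add)
  moreover have "m (1 / real k) = subseq_limit"
    using k by (simp add: m_def subseq_limit_def algebra_simps)
  ultimately show ?thesis by simp
qed

lemma variance_L_staircase_subseq_bigo:
  "(\<lambda>n. variance_of L_staircase_subseq k n
      - (subseq_limit - (3 * real k - 2) * (real k ^ 2 - 15 * real k + 10) / real k ^ 4) * real n)
    \<in> O(\<lambda>_. 1)"
proof -
  obtain B where B: "\<And>n. \<bar>variance_of L_staircase_subseq k (Suc n) - slope k * n\<bar> \<le> B"
    using variance_L_staircase_subseq[OF k] by blast
  \<comment> \<open>The subtracted fraction equals \<open>rate - 5 * rate^2\<close>.\<close>
  have slope: "subseq_limit - (3 * real k - 2) * (real k ^ 2 - 15 * real k + 10) / real k ^ 4 = slope k"
    using k by (simp add: subseq_limit_def rate_def[OF k] divide_simps) algebra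
  show ?thesis
    unfolding slope
  \<comment> \<open>The extra \<open>\<bar>slope k\<bar>\<close> pays for replacing
    \<open>n - 1\<close> by \<open>n\<close>.\<close>
  proof (rule bigoI[where c = "B + \<bar>slope k\<bar>"], rule eventually_sequentiallyI[of 1])
    fix n :: nat assume "n \<ge> 1"
    then obtain m where "n = Suc m" by (cases n) auto
    then show "norm (variance_of L_staircase_subseq k n - slope k * real n)
        \<le> (B + \<bar>slope k\<bar>) * norm (1::real)"
      using B[of m] by (simp add: algebra_simps)
  qed
qed

end

theorem theorem1p1:
  fixes k :: nat
  assumes "k \<ge> 3"
  shows
    "(\<forall>n\<ge>1. mean_of staircase_sep k n =
        (real k - 2) * (real k - 1) / real k ^ 2 * (real n - 1))
   \<and> (\<forall>n\<ge>2. variance_of staircase_sep k n =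
        - 4 * (real k - 2) / real k ^ 4
        + (real k - 2) * (3 * real k ^ 2 - 5 * real k + 6) / real k ^ 4 * (real n - 1))
   \<and> (k \<ge> 4 \<longrightarrow> (\<lambda>n. mean_of L_staircase_subword k n) \<longlonglongrightarrow> e1 k)
   \<and> (\<lambda>n. mean_of L_staircase_subword 3 n - 5) \<in> o(\<lambda>_. 1)
   \<and> (k \<ge> 4 \<longrightarrow>
        (\<lambda>n. variance_of L_staircase_subword k n - (e1 k + e2 k - e1 k ^ 2)) \<in> o(\<lambda>_. 1))
   \<and> (\<lambda>n. variance_of L_staircase_subword 3 n - 21) \<in> o(\<lambda>_. 1)
   \<and> (\<forall>n\<ge>1. mean_of L_staircase_subseq k n =
        1 + (3 * real k - 2) / real k ^ 2 * (real n - 1))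
   \<and> (\<exists>a. (a_fun k \<longlongrightarrow> a) (at_left (1 / real k)) \<and>
        (\<lambda>n. variance_of L_staircase_subseq k n
              - (a - (3 * real k - 2) * (real k ^ 2 - 15 * real k + 10) / real k ^ 4) * real n)
          \<in> O(\<lambda>_. 1))"
proof -
  have o1: "(\<lambda>n. f n - c) \<in> o(\<lambda>_. 1)" if "f \<longlonglongrightarrow> c" for f :: "nat \<Rightarrow> real" and c
    using that by (intro smalloI_tendsto) (auto simp: LIM_zero_iff)
  have "mean_of L_staircase_subseq k n = 1 + (3 * real k - 2) / real k ^ 2 * (real n - 1)"
    if "n \<ge> 1" for n
    using that mean_L_staircase_subseq[OF assms, of "n - 1"]
    by (cases n) (auto simp: rate_def[OF assms])
  then show ?thesis
    using mean_staircase_sep[OF assms] variance_staircase_sep[OF assms]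
      run_limits_e1_e2[of k] run_limits_3[THEN o1] o1[OF run_limits_e1_e2(2)]
      a_fun_tendsto[OF assms] variance_L_staircase_subseq_bigo[OF assms]
    by (intro conjI impI allI exI[of _ "subseq_limit k"]) simp_all
qed

end
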